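(* Let $(\Omega,\mathcal{F},\mathbb{P})$ be a nonatomic probability space and let $(\Phi,\Psi)$ be an Orlicz pair as in the context. Let $\rho:L^\Phi\to(-\infty,\infty]$ be a proper, quasiconvex (in particular, any convex), law-invariant functional. Then the following statements are equivalent: (1) $\rho$ is $\sigma(L^\Phi,L^\infty)$ lower semicontinuous; (2) $\rho$ is $\sigma(L^\Phi,H^\Psi)$ lower semicontinuous; (3) $\rho$ is $\sigma(L^\Phi,L^\Psi)$ lower semicontinuous; (4) $\rho$ has the Fatou property.
   Context: $(\Omega,\mathcal{F},\mathbb{P})$ is a nonatomic probability space; random variables are identified up to a.s. equality. An Orlicz function is a convex, increasing $\Phi:[0,\infty)\to[0,\infty)$ with $\Phi(0)=0$; its conjugate is $\Psi(s)=\sup_{t\ge0}(ts-\Phi(t))$. Standing assumption: $\Phi(t)>0$ for $t>0$ and $\lim_{t\to\infty}\Phi(t)/t=\infty$ (so $\Psi$ is also a finite Orlicz function). $L^\Phi$ is the space of random variables $X$ with $\|X\|_\Phi:=\inf\{\lambda>0:\mathbb{E}[\Phi(|X|/\lambda)]\le 1\}<\infty$; the Orlicz heart is $H^\Phi=\{X\in L^\Phi:\mathbb{E}[\Phi(|X|/\lambda)]<\infty \text{ for all }\lambda>0\}$; $L^\Psi$ and $H^\Psi$ are defined analogously. One has $L^\infty\subset H^\Phi\subset L^\Phi\subset L^1$, and the weak topologies $\sigma(L^\Phi,\cdot)$ refer to the pairing $\langle X,Y\rangle=\mathbb{E}[XY]$. A functional is proper if it is not identically $\infty$; quasiconvex if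 each sublevel set $\{\rho\le\lambda\}$, $\lambda\in\mathbb{R}$, is convex; law-invariant if $\rho(X)=\rho(Y)$ whenever $X,Y$ have the same law. $\rho$ has the Fatou property if whenever $X_n\to X$ a.s. and $|X_n|\le Y$ for some $Y\in L^\Phi$ and all $n$, then $\rho(X)\le\liminf_n\rho(X_n)$. *)

theory Defs
  imports "HOL-Probability.Probability"
begin

definition nonatomic :: "'a measure \<Rightarrow> bool" where
  "nonatomic M \<longleftrightarrow> (\<forall>A\<in>sets M. measure M A > 0 \<longrightarrow>
      (\<exists>B\<in>sets M. B \<subseteq> A \<and> 0 < measure M B \<and> measure M B < measure M A))"

definition orlicz_function :: "(real \<Rightarrow> real) \<Rightarrow> bool" where
  "orlicz_function \<Phi> \<longleftrightarrow> convex_on {0..} \<Phi> \<and> mono_on {0..} \<Phi> \<and> \<Phi> 0 = 0"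

definition orlicz_conj :: "(real \<Rightarrow> real) \<Rightarrow> real \<Rightarrow> real" where
  "orlicz_conj \<Phi> s = (SUP t\<in>{0::real..}. t * s - \<Phi> t)"

text \<open>Orlicz space: measurable X with finite Luxemburg norm, i.e. some
  lambda > 0 with E[Phi(|X|/lambda)] <= 1.\<close>
definition orlicz_space :: "'a measure \<Rightarrow> (real \<Rightarrow> real) \<Rightarrow> ('a \<Rightarrow> real) set" where
  "orlicz_space M \<Phi> = {X \<in> borel_measurable M.
      \<exists>c>0. (\<integral>\<^sup>+ \<omega>. ennreal (\<Phi> (\<bar>X \<omega>\<bar> / c)) \<partial>M) \<le> 1}"

definition orlicz_heart :: "'a measure \<Rightarrow> (real \<Rightarrow> real) \<Rightarrow> ('a \<Rightarrow> real) set" where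
  "orlicz_heart M \<Phi> = {X \<in> orlicz_space M \<Phi>.
      \<forall>c>0. (\<integral>\<^sup>+ \<omega>. ennreal (\<Phi> (\<bar>X \<omega>\<bar> / c)) \<partial>M) < \<infinity>}"

definition Linfty :: "'a measure \<Rightarrow> ('a \<Rightarrow> real) set" where
  "Linfty M = {X \<in> borel_measurable M. \<exists>C. AE \<omega> in M. \<bar>X \<omega>\<bar> \<le> C}"

definition weak_topology ::
  "'a measure \<Rightarrow> (real \<Rightarrow> real) \<Rightarrow> ('a \<Rightarrow> real) set \<Rightarrow> ('a \<Rightarrow> real) topology" where
  "weak_topology M \<Phi> D = topology_generated_by
     (insert (orlicz_space M \<Phi>)
       {{X \<in> orlicz_space M \<Phi>. (\<integral>\<omega>. X \<omega> * Y \<omega> \<partial>M) \<in> U} | Y U. Y \<in> D \<and> open U})"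

definition weakly_lsc ::
  "'a measure \<Rightarrow> (real \<Rightarrow> real) \<Rightarrow> ('a \<Rightarrow> real) set \<Rightarrow> (('a \<Rightarrow> real) \<Rightarrow> ereal) \<Rightarrow> bool" where
  "weakly_lsc M \<Phi> D \<rho> \<longleftrightarrow>
     (\<forall>c::real. closedin (weak_topology M \<Phi> D) {X \<in> orlicz_space M \<Phi>. \<rho> X \<le> ereal c})"

definition proper_fun :: "'a measure \<Rightarrow> (real \<Rightarrow> real) \<Rightarrow> (('a \<Rightarrow> real) \<Rightarrow> ereal) \<Rightarrow> bool" where
  "proper_fun M \<Phi> \<rho> \<longleftrightarrow> (\<exists>X\<in>orlicz_space M \<Phi>. \<rho> X \<noteq> \<infinity>)"

definition quasiconvex :: "'a measure \<Rightarrow> (real \<Rightarrow> real) \<Rightarrow> (('a \<Rightarrow> real) \<Rightarrow> ereal) \<Rightarrow> bool" where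
  "quasiconvex M \<Phi> \<rho> \<longleftrightarrow> (\<forall>c::real. \<forall>X Y t.
      X \<in> orlicz_space M \<Phi> \<and> \<rho> X \<le> ereal c \<and> Y \<in> orlicz_space M \<Phi> \<and> \<rho> Y \<le> ereal c \<and>
      0 \<le> t \<and> t \<le> 1 \<longrightarrow>
      (\<lambda>\<omega>. t * X \<omega> + (1 - t) * Y \<omega>) \<in> orlicz_space M \<Phi> \<and>
      \<rho> (\<lambda>\<omega>. t * X \<omega> + (1 - t) * Y \<omega>) \<le> ereal c)"

definition law_invariant :: "'a measure \<Rightarrow> (real \<Rightarrow> real) \<Rightarrow> (('a \<Rightarrow> real) \<Rightarrow> ereal) \<Rightarrow> bool" where
  "law_invariant M \<Phi> \<rho> \<longleftrightarrow> (\<forall>X\<in>orlicz_space M \<Phi>. \<forall>Y\<in>orlicz_space M \<Phi>.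
      distr M borel X = distr M borel Y \<longrightarrow> \<rho> X = \<rho> Y)"

definition fatou_property :: "'a measure \<Rightarrow> (real \<Rightarrow> real) \<Rightarrow> (('a \<Rightarrow> real) \<Rightarrow> ereal) \<Rightarrow> bool" where
  "fatou_property M \<Phi> \<rho> \<longleftrightarrow> (\<forall>Xs X Y.
      (\<forall>n. Xs n \<in> orlicz_space M \<Phi>) \<and> X \<in> orlicz_space M \<Phi> \<and> Y \<in> orlicz_space M \<Phi> \<and>
      (AE \<omega> in M. (\<lambda>n. Xs n \<omega>) \<longlonglongrightarrow> X \<omega>) \<and>
      (\<forall>n. AE \<omega> in M. \<bar>Xs n \<omega>\<bar> \<le> Y \<omega>) \<longrightarrow>
      \<rho> X \<le> liminf (\<lambda>n. \<rho> (Xs n)))"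

end

theory Submission
  imports Defs
begin

text \<open>
  By Young's inequality and dominated convergence every dominated almost sure limit is a
  \<open>\<sigma>(L\<^sup>\<Phi>, L\<^sup>\<Psi>)\<close>-limit, so weak lower semicontinuity implies the Fatou property, and \<open>L\<^sup>\<infinity> \<subseteq> H\<^sup>\<Psi> \<subseteq> L\<^sup>\<Psi>\<close> orders the three weak topologies. It remains
  to see that a sublevel set \<open>C\<close>, which is convex, law-invariant and closed under dominated limits, is
  closed for the weakest of them.

  If the modular \<open>E \<Phi>(|Z\<^sub>n - Z| / c)\<close> of elements \<open>Z\<^sub>n\<close> of \<open>C\<close> tends to 0 for a single \<open>c\<close>, then a subsequence is
  dominated in \<open>L\<^sup>\<Phi>\<close> and converges almost surely, so \<open>Z \<in> C\<close>. On each cell of a finite partition, averages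
  of rearrangements of a truncation of \<open>X\<close> are Riemann sums of its quantile function and converge
  uniformly to the conditional mean, while the modular of the remaining tail only decreases under
  averaging; hence \<open>C\<close> is stable under conditional expectation given a finite partition. If \<open>X\<close> is in the
  weak closure of \<open>C\<close>, some \<open>Z \<in> C\<close> has nearly the same conditional expectation as \<open>X\<close>, and the latter
  approximates \<open>X\<close> when the partition consists of level sets of a truncation of \<open>X\<close>.
\<close>

section \<open>Nonatomic probability spaces carry a uniform random variable\<close>

text \<open>Of a proper piece of a set and its complement in that set, the lighter one has at most
  half the mass; iterating drives the mass below any bound while keeping it positive.\<close>

lemma (in finite_measure) nonatomic_small_subset:
  assumes na: "nonatomic M" and A: "A \<in> sets M" "measure M A > 0" and e: "e > 0"
  shows "\<exists>C\<in>sets M. C \<subseteq> A \<and> 0 < measure M C \<and> measure M C \<le> e"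
proof -
  have halves: "\<exists>C\<in>sets M. C \<subseteq> A \<and> 0 < measure M C \<and> measure M C \<le> measure M A / 2 ^ n" for n
  proof (induction n)
    case 0
    then show ?case using A by (intro bexI[of _ A]) simp_all
  next
    case (Suc n)
    then obtain C where C: "C \<in> sets M" "C \<subseteq> A" "0 < measure M C" "measure M C \<le> measure M A / 2 ^ n"
      by blast
    obtain B where B: "B \<in> sets M" "B \<subseteq> C" "0 < measure M B" "measure M B < measure M C"
      using na C unfolding nonatomic_def by blast
    have d: "measure M (C - B) = measure M C - measure M B"
      using B C by (intro finite_measure_Diff) auto
    show ?case
    proof (cases "measure M B \<le> measure M C / 2")
      case True
      then have "measure M B \<le> measure M A / 2 ^ Suc n" using C(4) by simp
      then show ?thesis using B C(2) by (intro bexI[of _ B] conjI) (blast+)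
    next
      case False
      then have "measure M (C - B) \<le> measure M A / 2 ^ Suc n" using C(4) d by simp
      moreover have "0 < measure M (C - B)" using B d by simp
      ultimately show ?thesis using B(1) C(1,2) by (intro bexI[of _ "C - B"] conjI) auto
    qed
  qed
  have "\<exists>n. measure M A / e < 2 ^ n"
    by (rule real_arch_pow) simp
  then obtain n where n: "measure M A / e < 2 ^ n" ..
  then have "measure M A / 2 ^ n \<le> e"
    using e by (simp add: field_simps)
  with halves[of n] order_trans show ?thesis by blast
qed

text \<open>Greedy exhaustion: each step realizes at least half of the mass that can still be added.\<close>

lemma (in finite_measure) nonatomic_subset_measure_eq:
  assumes na: "nonatomic M" and A: "A \<in> sets M" and t: "0 \<le> t" "t \<le> measure M A"
  shows "\<exists>B\<in>sets M. B \<subseteq> A \<and> measure M B = t"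
proof -
  define adm where "adm B \<longleftrightarrow> B \<in> sets M \<and> B \<subseteq> A \<and> measure M B \<le> t" for B
  define s where "s B = (SUP B'\<in>{B'. adm B' \<and> B \<subseteq> B'}. measure M B')" for B
  have bdd: "bdd_above (measure M ` {B'. adm B' \<and> B \<subseteq> B'})" for B
    by (auto simp: adm_def intro!: bdd_aboveI[of _ t])
  have step: "\<exists>B'. adm B' \<and> (B \<subseteq> B' \<and> measure M B' \<ge> (measure M B + s B) / 2)" if "adm B" for B
  proof (rule ccontr)
    assume *: "\<not> ?thesis"
    \<comment> \<open>Without a superset reaching the midpoint, the supremum \<open>s B\<close> is
      at most the midpoint, hence at most \<open>measure M B\<close>; but \<open>B\<close> is one of
      the competing sets and lies strictly below the midpoint.\<close>
    have "s B \<le> (measure M B + s B) / 2"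
      unfolding s_def[of B] using that *
      by (intro cSUP_least) (auto simp: s_def intro: less_imp_le)
    moreover have "measure M B < (measure M B + s B) / 2" using * that by auto
    ultimately show False by simp
  qed
  have "adm {}" using t by (simp add: adm_def)
  then have "\<exists>f. \<forall>n. adm (f n) \<and> f n \<subseteq> f (Suc n) \<and> measure M (f (Suc n)) \<ge> (measure M (f n) + s (f n)) / 2"
    using step by (intro dependent_nat_choice) blast+
  then obtain B where B: "\<And>n. adm (B n)"
    and BS: "\<And>n. B n \<subseteq> B (Suc n) \<and> measure M (B (Suc n)) \<ge> (measure M (B n) + s (B n)) / 2"
    by blast
  have inc: "incseq B" using BS by (intro incseq_SucI) auto
  let ?B = "\<Union>n. B n"
  have Bm: "?B \<in> sets M" "?B \<subseteq> A" using B by (auto simp: adm_def)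
  have lim: "(\<lambda>n. measure M (B n)) \<longlonglongrightarrow> measure M ?B"
    using B inc by (intro finite_Lim_measure_incseq) (auto simp: adm_def)
  have le: "measure M ?B \<le> t"
    using B by (intro LIMSEQ_le_const2[OF lim]) (auto simp: adm_def)
  \<comment> \<open>Such a \<open>B'\<close> competes in every \<open>s (B n)\<close>, so each step
    covers at least half of the remaining distance to \<open>measure M B'\<close>.\<close>
  have maximal: "measure M B' \<le> measure M ?B" if "adm B'" "?B \<subseteq> B'" for B'
  proof -
    have "(measure M (B n) + measure M B') / 2 \<le> measure M (B (Suc n))" for n
    proof -
      have "measure M B' \<le> s (B n)"
        unfolding s_def using that by (intro cSUP_upper bdd) auto
      then show ?thesis using BS[of n] by (simp add: field_simps)
    qed
    moreover have "(\<lambda>n. (measure M (B n) + measure M B') / 2) \<longlonglongrightarrow> (measure M ?B + measure M B') / 2"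
      by (intro tendsto_intros lim) auto
    ultimately have "(measure M ?B + measure M B') / 2 \<le> measure M ?B"
      using LIMSEQ_Suc[OF lim] by (intro LIMSEQ_le) auto
    then show ?thesis by simp
  qed
  have "measure M ?B = t"
  proof (rule ccontr)
    assume "measure M ?B \<noteq> t"
    with le have lt: "measure M ?B < t" by simp
    have "measure M (A - ?B) = measure M A - measure M ?B"
      using A Bm by (intro finite_measure_Diff) auto
    with lt t have "measure M (A - ?B) > 0" by simp
    then obtain C where C: "C \<in> sets M" "C \<subseteq> A - ?B" "0 < measure M C" "measure M C \<le> t - measure M ?B"
      using nonatomic_small_subset[OF na, of "A - ?B" "t - measure M ?B"] A Bm lt by auto
    have "measure M (?B \<union> C) = measure M ?B + measure M C"
      using C Bm by (intro finite_measure_Union) auto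
    with maximal[of "?B \<union> C"] C Bm show False by (auto simp: adm_def)
  qed
  with Bm show ?thesis by blast
qed

text \<open>Repeated halving assigns binary digits to every point, and the number with these digits
  is uniform. Nonnegativity is recorded at every point because the bound for cyclic sums is later
  applied pointwise.\<close>

lemma (in prob_space) nonatomic_uniform_exists:
  assumes na: "nonatomic M"
  shows "\<exists>U\<in>borel_measurable M. (\<forall>\<omega>. 0 \<le> U \<omega>) \<and> (\<forall>x\<in>{0..1}. prob {\<omega>\<in>space M. U \<omega> \<le> x} = x)"
proof -
  have "\<exists>B. A \<in> sets M \<longrightarrow> B \<in> sets M \<and> B \<subseteq> A \<and> prob B = prob A / 2" for A
    using nonatomic_subset_measure_eq[OF na, of A "prob A / 2"] by auto
  then obtain h where h: "\<And>A. A \<in> sets M \<Longrightarrow> h A \<in> sets M \<and> h A \<subseteq> A \<and> prob (h A) = prob A / 2"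
    by metis
  \<comment> \<open>\<open>J n \<omega>\<close> numbers the cell of generation \<open>n\<close>
    containing \<open>\<omega>\<close>; the appended digit is 1 exactly on the half that
    \<open>h\<close> selects from that cell.\<close>
  define J where "J = rec_nat (\<lambda>_. 0::nat)
    (\<lambda>_ j \<omega>. 2 * j \<omega> + (if \<omega> \<in> h {\<omega>'\<in>space M. j \<omega>' = j \<omega>} then 1 else 0))"
  have J0: "J 0 \<omega> = 0" for \<omega> by (simp add: J_def)
  have JS: "J (Suc n) \<omega> = 2 * J n \<omega> + (if \<omega> \<in> h {\<omega>'\<in>space M. J n \<omega>' = J n \<omega>} then 1 else 0)" for n \<omega>
    by (simp add: J_def)
  define c where "c n k = {\<omega>\<in>space M. J n \<omega> = k}" for n k
  have cell: "c n k \<in> sets M \<and> prob (c n k) = (if k < 2 ^ n then 1 / 2 ^ n else 0)" for n k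
  proof (induction n arbitrary: k)
    case 0
    then show ?case by (auto simp: J0 c_def prob_space)
  next
    case (Suc n)
    let ?k = "k div 2"
    have m: "c n ?k \<in> sets M" using Suc by blast
    note hk = h[OF m]
    have hs: "h (c n ?k) \<subseteq> space M" using hk sets.sets_into_space by blast
    \<comment> \<open>The parent of cell \<open>k\<close> has number \<open>k div 2\<close>, and the
      parity of \<open>k\<close> tells whether the selected half or its complement is meant.\<close>
    have eq: "c (Suc n) k = (if even k then c n ?k - h (c n ?k) else h (c n ?k))"
    proof -
      have cm: "\<omega> \<in> c n ?k \<longleftrightarrow> \<omega> \<in> space M \<and> J n \<omega> = ?k" for \<omega>
        by (simp add: c_def)
      have bit: "2 * j + (if b then 1 else 0) = k \<longleftrightarrow> j = ?k \<and> (odd k \<longleftrightarrow> b)" for j b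
        by (cases b) (simp; presburger)+
      have "J (Suc n) \<omega> = k \<longleftrightarrow> J n \<omega> = ?k \<and> (odd k \<longleftrightarrow> \<omega> \<in> h (c n (J n \<omega>)))" for \<omega>
        unfolding JS c_def by (rule bit)
      then have "\<omega> \<in> c (Suc n) k \<longleftrightarrow> \<omega> \<in> space M \<and> J n \<omega> = ?k \<and> (odd k \<longleftrightarrow> \<omega> \<in> h (c n ?k))" for \<omega>
        unfolding c_def[of "Suc n"] mem_Collect_eq by metis
      then have mem: "\<omega> \<in> c (Suc n) k \<longleftrightarrow> \<omega> \<in> c n ?k \<and> (odd k \<longleftrightarrow> \<omega> \<in> h (c n ?k))" for \<omega>
        unfolding cm by blast
      show ?thesis
      proof (cases "even k")
        case True
        with mem show ?thesis by auto
      next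
        case False
        with mem hk show ?thesis by auto
      qed
    qed
    have "prob (c n ?k - h (c n ?k)) = prob (c n ?k) - prob (h (c n ?k))"
      using hk m by (intro finite_measure_Diff) auto
    moreover have "k div 2 < 2 ^ n \<longleftrightarrow> k < 2 ^ Suc n" by (simp add: div_less_iff_less_mult mult.commute)
    moreover have "prob (c n ?k) = (if ?k < 2 ^ n then 1 / 2 ^ n else 0)" using Suc by blast
    ultimately have "prob (c (Suc n) k) = (if k < 2 ^ Suc n then 1 / 2 ^ Suc n else 0)"
      unfolding eq using hk by (simp split: if_splits)
    moreover have "c (Suc n) k \<in> sets M" unfolding eq using hk m by (auto intro: sets.Diff)
    ultimately show ?case by blast
  qed
  have Jm[measurable]: "J n \<in> measurable M (count_space UNIV)" for n
    using cell[of n] by (subst measurable_count_space_eq_countable) (auto simp: c_def vimage_def Int_def conj_commute)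
  have below: "prob {\<omega>\<in>space M. J n \<omega> < k} = k / 2 ^ n" if "k \<le> 2 ^ n" for n k
    using that
  proof (induction k)
    case (Suc k)
    have "{\<omega>\<in>space M. J n \<omega> < Suc k} = {\<omega>\<in>space M. J n \<omega> < k} \<union> c n k"
      by (auto simp: c_def)
    also have "prob \<dots> = prob {\<omega>\<in>space M. J n \<omega> < k} + prob (c n k)"
      using cell by (intro finite_measure_Union) (auto simp: c_def)
    finally show ?case using Suc cell[of n k] by (auto simp: field_simps)
  qed simp
  have Jlt: "J n \<omega> < 2 ^ n" for n \<omega>
    by (induction n) (auto simp: J0 JS)
  define V where "V n \<omega> = real (J n \<omega>) / 2 ^ n" for n \<omega>
  \<comment> \<open>The dyadic intervals from \<open>V n \<omega>\<close> to
    \<open>V n \<omega> + 1 / 2 ^ n\<close> are nested, so the supremum of the left endpoints lies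
    in all of them.\<close>
  have Vinc: "V n \<omega> \<le> V (Suc n) \<omega>" for n \<omega>
    by (auto simp: V_def JS field_simps)
  have Vdec: "V (Suc n) \<omega> + 1 / 2 ^ Suc n \<le> V n \<omega> + 1 / 2 ^ n" for n \<omega>
    by (auto simp: V_def JS field_simps)
  have Vle: "V n \<omega> \<le> V m \<omega> + 1 / 2 ^ m" for n m \<omega>
  proof (cases "n \<le> m")
    case True
    then have "V n \<omega> \<le> V m \<omega>" using Vinc by (rule lift_Suc_mono_le[of "\<lambda>n. V n \<omega>", rotated])
    then show ?thesis by (rule order_trans) simp
  next
    case False
    have "decseq (\<lambda>n. V n \<omega> + 1 / 2 ^ n)"
      using Vdec by (intro decseq_SucI)
    from decseqD[OF this, of m n] False have "V n \<omega> + 1 / 2 ^ n \<le> V m \<omega> + 1 / 2 ^ m"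
      by simp
    moreover have "(0::real) \<le> 1 / 2 ^ n" by simp
    ultimately show ?thesis by linarith
  qed
  have Vbdd: "bdd_above (range (\<lambda>n. V n \<omega>))" for \<omega>
    using Vle[of _ \<omega> 0] by (auto intro!: bdd_aboveI)
  define U where "U \<omega> = (SUP n. V n \<omega>)" for \<omega>
  have U1: "V n \<omega> \<le> U \<omega>" for n \<omega>
    unfolding U_def by (intro cSUP_upper Vbdd) auto
  have U2: "U \<omega> \<le> V n \<omega> + 1 / 2 ^ n" for n \<omega>
    unfolding U_def using Vle by (intro cSUP_least) auto
  have Vm[measurable]: "V n \<in> borel_measurable M" for n
    unfolding V_def by measurable
  have Um[measurable]: "U \<in> borel_measurable M"
    unfolding U_def using Vbdd by (intro borel_measurable_cSUP) auto
  have "prob {\<omega>\<in>space M. U \<omega> \<le> x} = x" if x: "x \<in> {0..1}" for x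
  proof (cases "x = 1")
    case True
    have "U \<omega> \<le> 1" for \<omega> using U2[of \<omega> 0] by (simp add: V_def J0)
    then show ?thesis using True by (simp add: prob_space)
  next
    case False
    with x have x: "0 \<le> x" "x < 1" by auto
    \<comment> \<open>With \<open>k\<close> the integer part of \<open>x * 2 ^ n\<close>, the event
      \<open>U \<omega> \<le> x\<close> lies between \<open>J n \<omega> < k\<close> and
      \<open>J n \<omega> < Suc k\<close>, whose probabilities differ by \<open>1 / 2 ^ n\<close>.
      Since \<open>x < 1\<close> here, \<open>Suc k\<close> does not exceed \<open>2 ^ n\<close> and
      \<open>below\<close> applies to both.\<close>
    have approx: "\<bar>prob {\<omega>\<in>space M. U \<omega> \<le> x} - x\<bar> \<le> 1 / 2 ^ n" for n
    proof -
      define k where "k = nat \<lfloor>x * 2 ^ n\<rfloor>"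
      have k: "real k \<le> x * 2 ^ n" "x * 2 ^ n < real k + 1" using x by (auto simp: k_def)
      have "real k < 2 ^ n" using k(1) x(2)
        by (smt (verit, ccfv_SIG) mult_le_cancel_right2 mult_less_cancel_right2 zero_less_power)
      then have k3: "k < 2 ^ n" by (metis of_nat_less_iff of_nat_numeral of_nat_power)
      have "U \<omega> \<le> x" if "J n \<omega> < k" for \<omega>
      proof -
        have "V n \<omega> + 1 / 2 ^ n \<le> k / 2 ^ n"
          using that by (simp add: V_def divide_simps)
        also have "\<dots> \<le> x" using k by (simp add: divide_simps)
        finally show ?thesis using U2[of \<omega> n] by linarith
      qed
      then have "prob {\<omega>\<in>space M. J n \<omega> < k} \<le> prob {\<omega>\<in>space M. U \<omega> \<le> x}"
        by (intro finite_measure_mono) auto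
      moreover have "J n \<omega> < Suc k" if "U \<omega> \<le> x" for \<omega>
      proof -
        have "real (J n \<omega>) / 2 ^ n \<le> x" using that U1[of n \<omega>] by (simp add: V_def)
        then have "real (J n \<omega>) < real k + 1" using k by (simp add: divide_simps)
        then show ?thesis by linarith
      qed
      then have "prob {\<omega>\<in>space M. U \<omega> \<le> x} \<le> prob {\<omega>\<in>space M. J n \<omega> < Suc k}"
        by (intro finite_measure_mono) auto
      moreover have "real k / 2 ^ n \<le> x" "x \<le> real (Suc k) / 2 ^ n" using k by (auto simp: divide_simps)
      moreover have "real (Suc k) / 2 ^ n = real k / 2 ^ n + 1 / 2 ^ n" by (simp add: add_divide_distrib)
      ultimately show ?thesis using below[of k n] below[of "Suc k" n] k3 by simp
    qed
    have "(\<lambda>n. (1/2)^n) \<longlonglongrightarrow> (0::real)" by (intro LIMSEQ_realpow_zero) auto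
    then have "\<bar>prob {\<omega>\<in>space M. U \<omega> \<le> x} - x\<bar> \<le> 0"
      using approx by (intro LIMSEQ_le_const) (auto simp: power_divide)
    then show ?thesis by simp
  qed
  moreover have "0 \<le> U \<omega>" for \<omega> using U1[of 0 \<omega>] by (simp add: V_def J0)
  ultimately show ?thesis using Um by blast
qed

section \<open>Averages of equidistributed copies\<close>

text \<open>The distribution function has left limit \<open>y\<close> at \<open>y\<close>, so there
  is no atom.\<close>

lemma (in prob_space) uniform_prob_less:
  assumes [measurable]: "U \<in> borel_measurable M"
    and U: "\<And>x. x \<in> {0..1} \<Longrightarrow> prob {\<omega>\<in>space M. U \<omega> \<le> x} = x"
    and y: "y \<in> {0..1}"
  shows "prob {\<omega>\<in>space M. U \<omega> < y} = y"
proof (rule antisym)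
  have "prob {\<omega>\<in>space M. U \<omega> < y} \<le> prob {\<omega>\<in>space M. U \<omega> \<le> y}"
    by (intro finite_measure_mono) auto
  then show "prob {\<omega>\<in>space M. U \<omega> < y} \<le> y" using U[OF y] by simp
  show "y \<le> prob {\<omega>\<in>space M. U \<omega> < y}"
  proof (cases "y = 0")
    case False
    with y have "0 < y" by simp
    then show ?thesis
    proof (rule dense_le_bounded)
      fix x assume x: "0 < x" "x < y"
      have "prob {\<omega>\<in>space M. U \<omega> \<le> x} \<le> prob {\<omega>\<in>space M. U \<omega> < y}"
        using x by (intro finite_measure_mono) auto
      then show "x \<le> prob {\<omega>\<in>space M. U \<omega> < y}" using U[of x] x y by simp
    qed
  qed simp
qed

section \<open>Rotations of the circle and quantile functions\<close>

lemma frac_measurable[measurable]: "(frac :: real \<Rightarrow> real) \<in> borel_measurable borel"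
  unfolding frac_def[abs_def] by measurable

text \<open>Rotating the circle by \<open>s\<close> preserves the uniform law: the preimage of an
  initial interval is one interval if \<open>x < s\<close>, and otherwise consists of two pieces of
  the same total length.\<close>

lemma (in prob_space) uniform_frac_shift:
  assumes Um[measurable]: "U \<in> borel_measurable M"
    and U: "\<And>x. x \<in> {0..1} \<Longrightarrow> prob {\<omega>\<in>space M. U \<omega> \<le> x} = x"
    and s: "0 \<le> s" "s < 1" and x: "x \<in> {0..1}"
  shows "prob {\<omega>\<in>space M. frac (U \<omega> + s) \<le> x} = x"
proof (cases "x = 1")
  case True
  then show ?thesis by (simp add: prob_space less_imp_le[OF frac_lt_1])
next
  case False
  with x have x: "0 \<le> x" "x < 1" by auto
  note less = uniform_prob_less[OF Um U]
  have "AE \<omega> in M. 0 < U \<omega>"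
    using U[of 0] prob_Collect_eq_0[of "\<lambda>\<omega>. U \<omega> \<le> 0"] by (simp add: not_le)
  moreover have "AE \<omega> in M. U \<omega> \<le> 1"
    using U[of 1] by (subst prob_Collect_eq_1[symmetric]) simp_all
  ultimately have ae: "AE \<omega> in M. 0 < U \<omega> \<and> U \<omega> \<le> 1" by eventually_elim simp
  have fr: "frac (u + s) = (if u < 1 - s then u + s else u + s - 1)" if "0 < u \<and> u \<le> 1" for u
    using that s by (auto simp: frac_unique_iff)
  show ?thesis
  proof (cases "x < s")
    case True
    have "AE \<omega> in M. frac (U \<omega> + s) \<le> x \<longleftrightarrow> 1 - s \<le> U \<omega> \<and> U \<omega> \<le> 1 - s + x"
      using ae by (rule eventually_mono) (use True x s in \<open>auto simp: fr\<close>)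
    then have "prob {\<omega>\<in>space M. frac (U \<omega> + s) \<le> x} = prob {\<omega>\<in>space M. 1 - s \<le> U \<omega> \<and> U \<omega> \<le> 1 - s + x}"
      by (intro measure_eq_AE) simp_all
    also have "{\<omega>\<in>space M. 1 - s \<le> U \<omega> \<and> U \<omega> \<le> 1 - s + x}
        = {\<omega>\<in>space M. U \<omega> \<le> 1 - s + x} - {\<omega>\<in>space M. U \<omega> < 1 - s}" by auto
    also have "prob \<dots> = prob {\<omega>\<in>space M. U \<omega> \<le> 1 - s + x} - prob {\<omega>\<in>space M. U \<omega> < 1 - s}"
      using x by (intro finite_measure_Diff) auto
    also have "\<dots> = x" using less[of "1 - s"] U[of "1 - s + x"] x s True by simp
    finally show ?thesis .
  next
    case False
    have "AE \<omega> in M. frac (U \<omega> + s) \<le> x \<longleftrightarrow> U \<omega> \<le> x - s \<or> \<not> U \<omega> < 1 - s"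
      using ae by (rule eventually_mono) (use False x s in \<open>auto simp: fr\<close>)
    then have "prob {\<omega>\<in>space M. frac (U \<omega> + s) \<le> x}
        = prob ({\<omega>\<in>space M. U \<omega> \<le> x - s} \<union> {\<omega>\<in>space M. \<not> U \<omega> < 1 - s})"
      by (intro measure_eq_AE) (simp_all, measurable)
    also have "\<dots> = prob {\<omega>\<in>space M. U \<omega> \<le> x - s} + prob {\<omega>\<in>space M. \<not> U \<omega> < 1 - s}"
      using x by (intro finite_measure_Union) auto
    also have "\<dots> = x"
      using less[of "1 - s"] U[of "x - s"] x s False prob_neg[of "\<lambda>\<omega>. U \<omega> < 1 - s"] by simp
    finally show ?thesis .
  qed
qed

text \<open>\<open>D.I\<close> is the generalized inverse of the distribution function, and the
  equivalence of \<open>D.I v \<le> x\<close> with \<open>v \<le> D.C x\<close> transfers the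
  uniform law to the law of \<open>X\<close>. One \<open>q\<close> serves all uniform variables, so
  it can be applied to all rotations of a single one.\<close>

lemma (in prob_space) quantile_exists:
  fixes X :: "'a \<Rightarrow> real"
  assumes X[measurable]: "X \<in> borel_measurable M"
  shows "\<exists>q\<in>borel_measurable borel. mono_on {0<..<1} q \<and>
    (\<forall>V\<in>borel_measurable M. (\<forall>x\<in>{0..1}. prob {\<omega>\<in>space M. V \<omega> \<le> x} = x) \<longrightarrow>
      distr M borel (\<lambda>\<omega>. q (V \<omega>)) = distr M borel X)"
proof -
  interpret D: cdf_distribution "distr M borel X"
    unfolding cdf_distribution_def using X by (rule real_distribution_distr)
  \<comment> \<open>The value 0 outside the open unit interval makes \<open>q\<close> Borel
    measurable on the whole line, while monotonicity is claimed on the open interval only.\<close>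
  define q where "q v = (if v \<in> {0<..<1} then D.I v else 0)" for v :: real
  have qm[measurable]: "q \<in> borel_measurable borel"
  proof -
    have "{x::real. 0 < x \<and> x < 1} = {0<..<1}" by auto
    then show ?thesis unfolding q_def by (subst measurable_If_restrict_space_iff) auto
  qed
  have "mono_on {0<..<1} q"
    using D.mono_I by (auto simp: q_def mono_on_def)
  moreover have "distr M borel (\<lambda>\<omega>. q (V \<omega>)) = distr M borel X"
    if V[measurable]: "V \<in> borel_measurable M"
      and V': "\<And>x. x \<in> {0..1} \<Longrightarrow> prob {\<omega>\<in>space M. V \<omega> \<le> x} = x" for V
  proof (intro cdf_unique ext)
    fix x
    have "AE \<omega> in M. 0 < V \<omega>"
      using V'[of 0] prob_Collect_eq_0[of "\<lambda>\<omega>. V \<omega> \<le> 0"] by (simp add: not_le)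
    moreover have "AE \<omega> in M. V \<omega> < 1"
      using uniform_prob_less[OF V V', of 1] by (subst prob_Collect_eq_1[symmetric]) simp_all
    ultimately have "AE \<omega> in M. V \<omega> \<in> {0<..<1}" by eventually_elim simp
    moreover have "q v \<le> x \<longleftrightarrow> v \<le> D.C x" if "v \<in> {0<..<1}" for v
    proof -
      have "q v = D.I v" using that unfolding q_def by (rule if_P)
      moreover have "v \<le> D.C x \<longleftrightarrow> D.I v \<le> x" using that by (intro D.pseudoinverse) simp_all
      ultimately show ?thesis by metis
    qed
    ultimately have "AE \<omega> in M. (q (V \<omega>) \<le> x) = (V \<omega> \<le> D.C x)"
      by (rule eventually_mono)
    then have "prob {\<omega>\<in>space M. q (V \<omega>) \<le> x} = prob {\<omega>\<in>space M. V \<omega> \<le> D.C x}"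
      by (intro measure_eq_AE) auto
    also have "\<dots> = D.C x"
      using D.cdf_nonneg D.cdf_bounded_prob by (intro V') auto
    finally show "cdf (distr M borel (\<lambda>\<omega>. q (V \<omega>))) x = D.C x"
      unfolding cdf_def[of "distr M borel (\<lambda>\<omega>. q (V \<omega>))"]
      by (subst measure_distr) (auto simp: vimage_def Int_def conj_commute)
  qed (auto intro!: real_distribution_distr)
  ultimately show ?thesis using qm by blast
qed

section \<open>Truncation and Riemann sums of monotone functions\<close>

definition clip :: "real \<Rightarrow> real \<Rightarrow> real" where
  "clip K x = max (- K) (min K x)"

lemma clip_measurable[measurable]: "clip K \<in> borel_measurable borel"
  unfolding clip_def[abs_def] by measurable

lemma clip_mono: "x \<le> y \<Longrightarrow> clip K x \<le> clip K y"
  by (auto simp: clip_def)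

lemma abs_clip_le: "0 \<le> K \<Longrightarrow> \<bar>clip K x\<bar> \<le> K"
  by (auto simp: clip_def)

lemma abs_diff_clip_le: "0 \<le> K \<Longrightarrow> \<bar>x - clip K x\<bar> \<le> \<bar>x\<bar>"
  by (auto simp: clip_def)

lemma clip_eq: "\<bar>x\<bar> \<le> K \<Longrightarrow> clip K x = x"
  by (auto simp: clip_def)

text \<open>Only the value at 0 may violate monotonicity, whence 4 instead of 2.\<close>

lemma cyclic_sum_oscillation:
  fixes f :: "real \<Rightarrow> real"
  assumes f: "mono_on {0<..<1} f" and bd: "\<And>x. \<bar>f x\<bar> \<le> K" and n: "0 < n"
    and u: "0 \<le> u" and v: "0 \<le> v"
  shows "\<bar>(\<Sum>j<n. f (frac (u + real j / n))) - (\<Sum>j<n. f (frac (v + real j / n)))\<bar> \<le> 4 * K"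
proof -
  define S where "S u = (\<Sum>j<n. f (frac (u + real j / n)))" for u
  \<comment> \<open>A shift by \<open>1 / n\<close> permutes the sample points cyclically, so the
    base point may be moved into the interval from 0 to \<open>1 / n\<close>.\<close>
  have shift1: "S (u + 1 / n) = S u" for u
  proof -
    let ?g = "\<lambda>j. f (frac (u + real j / n))"
    have "S (u + 1 / n) = (\<Sum>j<n. ?g (Suc j))"
      unfolding S_def by (intro sum.cong refl arg_cong[where f=f] arg_cong[where f=frac]) (simp add: add_divide_distrib)
    moreover have "(\<Sum>j<Suc n. ?g j) = ?g 0 + (\<Sum>j<n. ?g (Suc j))"
      by (rule sum.lessThan_Suc_shift)
    moreover have "?g n = ?g 0" using n by (simp add: frac_def)
    ultimately show ?thesis by (simp add: S_def)
  qed
  have shift: "S (u + real k / n) = S u" for u k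
  proof (induction k)
    case (Suc k)
    have "S (u + real (Suc k) / n) = S ((u + real k / n) + 1 / n)"
      by (rule arg_cong[where f=S]) (simp add: add_divide_distrib)
    then show ?case using Suc shift1 by simp
  qed simp
  have reduce: "\<exists>r. 0 \<le> r \<and> r < 1 / n \<and> S u = S r" if "0 \<le> u" for u
  proof -
    define k where "k = nat \<lfloor>u * n\<rfloor>"
    have k: "real k \<le> u * n" "u * n < real k + 1"
      using that by (auto simp: k_def)
    have "0 \<le> u - real k / n" using k n by (simp add: field_simps)
    moreover have "u < (real k + 1) / n" using k n by (simp add: pos_less_divide_eq)
    then have "u - real k / n < 1 / n" by (simp add: add_divide_distrib)
    moreover have "S u = S (u - real k / n)" using shift[of "u - real k / n" k] by simp
    ultimately show ?thesis by blast
  qed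
  have le: "S r - S r' \<le> 4 * K" if r: "0 \<le> r" "r < 1 / n" and r': "0 \<le> r'" "r' < 1 / n" for r r'
  proof -
    obtain m where m: "n = Suc m" using n by (cases n) auto
    have fr: "frac (r + real j / n) = r + real j / n" if "0 \<le> r" "r < 1 / n" "j < n" for r j
    proof -
      have "r + real j / n < 1 / n + real j / n" using that by simp
      also have "\<dots> \<le> 1" using that by (simp add: field_simps)
      finally show ?thesis using that by (simp add: frac_eq)
    qed
    define a where "a j = f (r + real j / n)" for j
    define b where "b j = f (r' + real j / n)" for j
    define a' where "a' j = (if j = 0 then - K else a j)" for j :: nat
    have Sa: "S r = sum a {..<n}" unfolding S_def a_def using fr[OF r] by (intro sum.cong) auto
    have Sb: "S r' = sum b {..<n}" unfolding S_def b_def using fr[OF r'] by (intro sum.cong) auto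
    have ba: "\<bar>a j\<bar> \<le> K" "\<bar>b j\<bar> \<le> K" for j unfolding a_def b_def using bd by auto
    \<comment> \<open>The two families of sample points interlace. After cancellation only
      \<open>a 0\<close>, \<open>K\<close>, \<open>a' m\<close> and \<open>- b 0\<close> survive,
      each at most \<open>K\<close>.\<close>
    have "a' j \<le> b (Suc j)" if "j < m" for j
    proof (cases "j = 0")
      case True
      then show ?thesis using ba(2)[of "Suc j"] by (simp add: a'_def)
    next
      case False
      have j1: "r + real j / n \<le> r' + real (Suc j) / n"
        using r r' by (simp add: add_divide_distrib)
      have j2: "0 < real j / n" using False n by simp
      have j3: "r' + real (Suc j) / n < 1"
      proof -
        have "r' + real (Suc j) / n < 1 / n + real (Suc j) / n" using r' by simp
        also have "\<dots> \<le> 1" using that m by (simp add: field_simps)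
        finally show ?thesis .
      qed
      have "f (r + real j / n) \<le> f (r' + real (Suc j) / n)"
        using j1 j2 j3 r r' by (intro mono_onD[OF f]) auto
      then show ?thesis using False by (simp add: a'_def a_def b_def)
    qed
    then have 1: "sum a' {..<m} \<le> (\<Sum>j<m. b (Suc j))" by (intro sum_mono) auto
    have 2: "sum b {..<n} = b 0 + (\<Sum>j<m. b (Suc j))" unfolding m by (rule sum.lessThan_Suc_shift)
    have 3: "sum a' {..<n} = sum a' {..<m} + a' m" unfolding m by simp
    have 4: "sum a {..<n} - sum a' {..<n} = a 0 + K"
      unfolding m sum.lessThan_Suc_shift by (simp add: a'_def)
    have 5: "a' m \<le> K" using ba[of m] by (auto simp: a'_def)
    show ?thesis using 1 2 3 4 5 ba[of 0] unfolding Sa Sb by linarith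
  qed
  obtain r where r: "0 \<le> r" "r < 1 / n" "S u = S r" using reduce[OF u] by blast
  obtain r' where r': "0 \<le> r'" "r' < 1 / n" "S v = S r'" using reduce[OF v] by blast
  have "\<bar>S u - S v\<bar> \<le> 4 * K" using le[OF r(1,2) r'(1,2)] le[OF r'(1,2) r(1,2)] r(3) r'(3) by linarith
  then show ?thesis by (simp add: S_def)
qed

text \<open>The copies are \<open>q (frac (U + j / n))\<close> for a uniform variable \<open>U\<close> and the quantile function \<open>q\<close>
  of \<open>X\<close>, so their averages are Riemann sums of a monotone function.\<close>

lemma (in prob_space) nonatomic_equidistributed_average:
  fixes X :: "'a \<Rightarrow> real" and n :: nat
  assumes na: "nonatomic M" and X[measurable]: "X \<in> borel_measurable M" and n: "0 < n"
  shows "\<exists>Y. (\<forall>j. Y j \<in> borel_measurable M \<and> (j < n \<longrightarrow> distr M borel (Y j) = distr M borel X)) \<and>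
    (\<forall>K\<ge>0. \<forall>\<omega>. \<bar>(\<Sum>j<n. clip K (Y j \<omega>)) / n - expectation (\<lambda>\<omega>. clip K (X \<omega>))\<bar> \<le> 4 * K / n)"
proof -
  obtain U where U[measurable]: "U \<in> borel_measurable M" and U0: "\<And>\<omega>. 0 \<le> U \<omega>"
    and U1: "\<And>x. x \<in> {0..1} \<Longrightarrow> prob {\<omega>\<in>space M. U \<omega> \<le> x} = x"
    using nonatomic_uniform_exists[OF na] by blast
  obtain q where q[measurable]: "q \<in> borel_measurable borel" and mono: "mono_on {0<..<1} q"
    and law: "\<And>V. V \<in> borel_measurable M \<Longrightarrow> (\<And>x. x \<in> {0..1} \<Longrightarrow> prob {\<omega>\<in>space M. V \<omega> \<le> x} = x) \<Longrightarrow>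
      distr M borel (\<lambda>\<omega>. q (V \<omega>)) = distr M borel X"
    using quantile_exists[OF X] by blast
  define V where "V j \<omega> = frac (U \<omega> + real j / n)" for j \<omega>
  have Vm[measurable]: "V j \<in> borel_measurable M" for j
    unfolding V_def by measurable
  define Y where "Y j \<omega> = q (V j \<omega>)" for j \<omega>
  have Ym[measurable]: "Y j \<in> borel_measurable M" for j unfolding Y_def by measurable
  have Yd: "distr M borel (Y j) = distr M borel X" if "j < n" for j
    unfolding Y_def[abs_def] using that
    by (intro law) (auto simp: V_def intro!: uniform_frac_shift[OF U U1])
  have avg: "\<bar>(\<Sum>j<n. clip K (Y j \<omega>)) / n - expectation (\<lambda>\<omega>. clip K (X \<omega>))\<bar> \<le> 4 * K / n"
    if K: "0 \<le> K" for K \<omega>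
  proof -
    define S where "S \<omega> = (\<Sum>j<n. clip K (Y j \<omega>))" for \<omega>
    have osc: "\<bar>S \<omega> - S \<omega>'\<bar> \<le> 4 * K" for \<omega> \<omega>'
      unfolding S_def Y_def V_def
      using mono U0 n K
      by (intro cyclic_sum_oscillation[where f="\<lambda>x. clip K (q x)"])
         (auto simp: mono_on_def intro: clip_mono abs_clip_le)
    have int: "integrable M (\<lambda>\<omega>. clip K (Z \<omega>))" if "Z \<in> borel_measurable M" for Z
      using that abs_clip_le[OF K] by (intro integrable_const_bound[of _ K]) auto
    have "expectation S = (\<Sum>j<n. expectation (\<lambda>\<omega>. clip K (Y j \<omega>)))"
      unfolding S_def[abs_def] by (intro Bochner_Integration.integral_sum int Ym)
    also have "\<dots> = (\<Sum>j<n. expectation (\<lambda>\<omega>. clip K (X \<omega>)))"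
    proof (intro sum.cong refl)
      fix j assume "j \<in> {..<n}"
      have "expectation (\<lambda>\<omega>. clip K (Y j \<omega>)) = integral\<^sup>L (distr M borel (Y j)) (clip K)"
        by (subst integral_distr) auto
      also have "\<dots> = integral\<^sup>L (distr M borel X) (clip K)"
        using Yd \<open>j \<in> {..<n}\<close> by simp
      also have "\<dots> = expectation (\<lambda>\<omega>. clip K (X \<omega>))"
        by (subst integral_distr) auto
      finally show "expectation (\<lambda>\<omega>. clip K (Y j \<omega>)) = expectation (\<lambda>\<omega>. clip K (X \<omega>))" .
    qed
    finally have ES: "expectation S = n * expectation (\<lambda>\<omega>. clip K (X \<omega>))" by simp
    have Si: "integrable M S" unfolding S_def[abs_def] by (intro Bochner_Integration.integrable_sum int Ym)
    \<comment> \<open>Averaging the oscillation bound over \<open>\<omega>'\<close> replaces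
      \<open>S \<omega>'\<close> by its mean, which equidistribution identifies as \<open>n\<close>
      times the truncated mean of \<open>X\<close>.\<close>
    have "\<bar>expectation (\<lambda>\<omega>'. S \<omega> - S \<omega>')\<bar> \<le> expectation (\<lambda>\<omega>'. 4 * K)"
      using osc Si by (intro integral_abs_bound[THEN order_trans] integral_mono) auto
    then have "\<bar>S \<omega> - n * expectation (\<lambda>\<omega>. clip K (X \<omega>))\<bar> \<le> 4 * K"
      using Si by (simp add: ES prob_space)
    then have "\<bar>(S \<omega> - n * expectation (\<lambda>\<omega>. clip K (X \<omega>))) / n\<bar> \<le> 4 * K / n"
      using n by (simp add: divide_right_mono)
    then show ?thesis using n by (simp add: S_def diff_divide_distrib)
  qed
  show ?thesis
    using Ym Yd avg by (intro exI[of _ Y]) blast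
qed

section \<open>Orlicz spaces and modulars\<close>

lemma orlicz_function_mono:
  "orlicz_function \<Phi> \<Longrightarrow> 0 \<le> s \<Longrightarrow> s \<le> t \<Longrightarrow> \<Phi> s \<le> \<Phi> t"
  unfolding orlicz_function_def by (auto intro: mono_onD)

lemma orlicz_function_nonneg: "orlicz_function \<Phi> \<Longrightarrow> 0 \<le> t \<Longrightarrow> 0 \<le> \<Phi> t"
  using orlicz_function_mono[of \<Phi> 0 t] by (simp add: orlicz_function_def)

lemma orlicz_function_scale:
  assumes "orlicz_function \<Phi>" "0 \<le> a" "a \<le> 1" "0 \<le> t"
  shows "\<Phi> (a * t) \<le> a * \<Phi> t"
  using assms convex_onD[of "{0..}" \<Phi> a 0 t] by (simp add: orlicz_function_def)

text \<open>Moves convexity from the half-line to the whole line, where Jensen's inequality is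
  applied to signed variables.\<close>

lemma convex_on_orlicz_abs:
  assumes \<Phi>: "orlicz_function \<Phi>" and c: "0 < c"
  shows "convex_on UNIV (\<lambda>x. \<Phi> (\<bar>x\<bar> / c))"
proof (rule convex_onI)
  fix t x y :: real assume t: "0 < t" "t < 1"
  have "\<bar>(1 - t) * x + t * y\<bar> \<le> (1 - t) * \<bar>x\<bar> + t * \<bar>y\<bar>"
    using abs_triangle_ineq[of "(1 - t) * x" "t * y"] t by (simp add: abs_mult)
  then have "\<bar>(1 - t) * x + t * y\<bar> / c \<le> ((1 - t) * \<bar>x\<bar> + t * \<bar>y\<bar>) / c"
    using c by (intro divide_right_mono) auto
  also have "\<dots> = (1 - t) * (\<bar>x\<bar> / c) + t * (\<bar>y\<bar> / c)"
    by (simp add: add_divide_distrib)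
  finally have "\<Phi> (\<bar>(1 - t) * x + t * y\<bar> / c) \<le> \<Phi> ((1 - t) * (\<bar>x\<bar> / c) + t * (\<bar>y\<bar> / c))"
    using c by (intro orlicz_function_mono[OF \<Phi>]) auto
  also have "\<dots> \<le> (1 - t) * \<Phi> (\<bar>x\<bar> / c) + t * \<Phi> (\<bar>y\<bar> / c)"
    using \<Phi> t c convex_onD[of "{0..}" \<Phi> t "\<bar>x\<bar> / c" "\<bar>y\<bar> / c"] by (simp add: orlicz_function_def)
  finally show "\<Phi> (\<bar>(1 - t) *\<^sub>R x + t *\<^sub>R y\<bar> / c) \<le> (1 - t) * \<Phi> (\<bar>x\<bar> / c) + t * \<Phi> (\<bar>y\<bar> / c)"
    by simp
qed simp

text \<open>Extended constantly to the left of 0, the function is monotone on the whole line and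
  hence Borel. This serves both \<open>\<Phi>\<close> and its conjugate.\<close>

lemma mono_on_abs_measurable:
  fixes f :: "real \<Rightarrow> real"
  assumes f: "mono_on {0..} f" and c: "0 < c"
  shows "(\<lambda>x::real. f (\<bar>x\<bar> / c)) \<in> borel_measurable borel"
proof -
  have "mono (\<lambda>x. f (max 0 x))"
    by (intro monoI mono_onD[OF f]) auto
  then have [measurable]: "(\<lambda>x. f (max 0 x)) \<in> borel_measurable borel"
    by (rule borel_measurable_mono)
  have "(\<lambda>x. f (max 0 (\<bar>x\<bar> / c))) \<in> borel_measurable borel"
    by measurable
  then show ?thesis using c by (simp add: max_absorb2)
qed

text \<open>The Orlicz modular of \<open>X / c\<close>. It takes the place of the Luxemburg norm
  because truncation tails become small at a fixed scale only.\<close>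

definition modular :: "'a measure \<Rightarrow> (real \<Rightarrow> real) \<Rightarrow> real \<Rightarrow> ('a \<Rightarrow> real) \<Rightarrow> ennreal" where
  "modular M \<Phi> c X = (\<integral>\<^sup>+ \<omega>. ennreal (\<Phi> (\<bar>X \<omega>\<bar> / c)) \<partial>M)"

locale orlicz_prob_space = prob_space M for M :: "'a measure" +
  fixes \<Phi> :: "real \<Rightarrow> real"
  assumes orlicz: "orlicz_function \<Phi>"
    and pos: "\<And>t. t > 0 \<Longrightarrow> \<Phi> t > 0"
    and superlinear: "((\<lambda>t. ereal (\<Phi> t / t)) \<longlongrightarrow> \<infinity>) at_top"
begin

lemmas \<Phi>_mono = orlicz_function_mono[OF orlicz]
lemmas \<Phi>_nonneg = orlicz_function_nonneg[OF orlicz]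
lemmas \<Phi>_scale = orlicz_function_scale[OF orlicz]

lemma \<Phi>_measurable: "0 < c \<Longrightarrow> (\<lambda>x::real. \<Phi> (\<bar>x\<bar> / c)) \<in> borel_measurable borel"
  using orlicz by (intro mono_on_abs_measurable) (simp_all add: orlicz_function_def)

lemma \<Phi>_0[simp]: "\<Phi> 0 = 0"
  using orlicz by (simp add: orlicz_function_def)

text \<open>The working form of superlinear growth, behind the integrability of Orlicz variables,
  the finiteness of the conjugate and its linear bound near 0.\<close>

lemma \<Phi>_dominates_linear: "\<exists>t0\<ge>0. \<forall>t\<ge>t0. K * t \<le> \<Phi> t"
proof -
  have "\<forall>\<^sub>F t in at_top. ereal K < ereal (\<Phi> t / t)"
    using order_tendstoD(1)[OF superlinear, of "ereal K"] by simp
  then obtain N where N: "\<And>t. N \<le> t \<Longrightarrow> K < \<Phi> t / t"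
    by (auto simp: eventually_at_top_linorder)
  have "K * t \<le> \<Phi> t" if "max 1 N \<le> t" for t
    using N[of t] that by (simp add: field_simps)
  then show ?thesis by (intro exI[of _ "max 1 N"]) auto
qed

section \<open>Inequalities for the modular\<close>

lemma modular_mono_AE:
  assumes "0 < c" "AE \<omega> in M. \<bar>X \<omega>\<bar> \<le> \<bar>Y \<omega>\<bar>"
  shows "modular M \<Phi> c X \<le> modular M \<Phi> c Y"
  unfolding modular_def using assms
  by (intro nn_integral_mono_AE) (auto elim!: eventually_mono intro!: ennreal_leI \<Phi>_mono divide_right_mono)

lemma modular_distr:
  assumes c: "0 < c" and [measurable]: "X \<in> borel_measurable M" "Y \<in> borel_measurable M"
    and d: "distr M borel X = distr M borel Y" and [measurable]: "f \<in> borel_measurable borel"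
  shows "modular M \<Phi> c (\<lambda>\<omega>. f (X \<omega>)) = modular M \<Phi> c (\<lambda>\<omega>. f (Y \<omega>))"
proof -
  note [measurable] = \<Phi>_measurable[OF c]
  have "modular M \<Phi> c (\<lambda>\<omega>. f (Z \<omega>)) = (\<integral>\<^sup>+ x. ennreal (\<Phi> (\<bar>f x\<bar> / c)) \<partial>distr M borel Z)"
    if [measurable]: "Z \<in> borel_measurable M" for Z
    unfolding modular_def by (subst nn_integral_distr) auto
  then show ?thesis using d by simp
qed

lemma modular_bounded:
  assumes "0 < c" "AE \<omega> in M. \<bar>X \<omega>\<bar> \<le> K"
  shows "modular M \<Phi> c X \<le> ennreal (\<Phi> (K / c))"
proof -
  have "modular M \<Phi> c X \<le> (\<integral>\<^sup>+ \<omega>. ennreal (\<Phi> (K / c)) \<partial>M)"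
    unfolding modular_def using assms
    by (intro nn_integral_mono_AE) (auto elim!: eventually_mono intro!: ennreal_leI \<Phi>_mono divide_right_mono)
  then show ?thesis by (simp add: emeasure_space_1)
qed

text \<open>A sum of two nonnegative numbers is at most twice the larger; doubling the scale absorbs
  the factor 2.\<close>

lemma modular_add_le:
  assumes c: "0 < c" and [measurable]: "X \<in> borel_measurable M" "Y \<in> borel_measurable M"
  shows "modular M \<Phi> (2 * c) (\<lambda>\<omega>. \<bar>X \<omega>\<bar> + \<bar>Y \<omega>\<bar>) \<le> modular M \<Phi> c X + modular M \<Phi> c Y"
proof -
  note [measurable] = \<Phi>_measurable[OF c]
  have "\<Phi> (\<bar>\<bar>x\<bar> + \<bar>y\<bar>\<bar> / (2 * c)) \<le> \<Phi> (\<bar>x\<bar> / c) + \<Phi> (\<bar>y\<bar> / c)" for x y :: real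
  proof -
    have "\<Phi> (\<bar>\<bar>x\<bar> + \<bar>y\<bar>\<bar> / (2 * c)) \<le> \<Phi> (max (\<bar>x\<bar> / c) (\<bar>y\<bar> / c))"
      using c by (intro \<Phi>_mono) (auto simp: field_simps max_def)
    also have "\<dots> \<le> \<Phi> (\<bar>x\<bar> / c) + \<Phi> (\<bar>y\<bar> / c)"
      using c \<Phi>_nonneg[of "\<bar>x\<bar> / c"] \<Phi>_nonneg[of "\<bar>y\<bar> / c"] by (auto simp: max_def)
    finally show ?thesis .
  qed
  then have "modular M \<Phi> (2 * c) (\<lambda>\<omega>. \<bar>X \<omega>\<bar> + \<bar>Y \<omega>\<bar>)
      \<le> (\<integral>\<^sup>+ \<omega>. ennreal (\<Phi> (\<bar>X \<omega>\<bar> / c)) + ennreal (\<Phi> (\<bar>Y \<omega>\<bar> / c)) \<partial>M)"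
    unfolding modular_def using c
    by (intro nn_integral_mono) (simp add: ennreal_plus[symmetric] \<Phi>_nonneg ennreal_leI del: ennreal_plus)
  also have "\<dots> = modular M \<Phi> c X + modular M \<Phi> c Y"
    unfolding modular_def by (intro nn_integral_add) auto
  finally show ?thesis .
qed

text \<open>Jensen's inequality for the weights \<open>1 / n\<close>, integrated term by
  term.\<close>

lemma modular_average_le:
  assumes c: "0 < c" and n: "0 < n" and [measurable]: "\<And>j. j < n \<Longrightarrow> T j \<in> borel_measurable M"
    and le: "\<And>j. j < n \<Longrightarrow> modular M \<Phi> c (T j) \<le> a"
  shows "modular M \<Phi> c (\<lambda>\<omega>. (\<Sum>j<n. T j \<omega>) / real n) \<le> a"
proof -
  note [measurable] = \<Phi>_measurable[OF c]
  have "\<Phi> (\<bar>(\<Sum>j<n. x j) / real n\<bar> / c) \<le> (\<Sum>j<n. (1 / real n) * \<Phi> (\<bar>x j\<bar> / c))" for x :: "nat \<Rightarrow> real"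
    using convex_on_sum[OF _ _ convex_on_orlicz_abs[OF orlicz c], of "{..<n}" "\<lambda>_. 1 / real n" x] n
    by (simp add: lessThan_empty_iff sum_divide_distrib)
  then have "modular M \<Phi> c (\<lambda>\<omega>. (\<Sum>j<n. T j \<omega>) / real n)
     \<le> (\<integral>\<^sup>+ \<omega>. (\<Sum>j<n. ennreal (1 / real n) * ennreal (\<Phi> (\<bar>T j \<omega>\<bar> / c))) \<partial>M)"
    unfolding modular_def using c n
    by (intro nn_integral_mono)
       (simp add: ennreal_mult[symmetric] \<Phi>_nonneg sum_ennreal ennreal_leI)
  also have "\<dots> = (\<Sum>j<n. ennreal (1 / real n) * modular M \<Phi> c (T j))"
    unfolding modular_def by (subst nn_integral_sum) (auto intro!: sum.cong nn_integral_cmult)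
  also have "\<dots> \<le> (\<Sum>j<n. ennreal (1 / real n) * a)"
    using le by (intro sum_mono mult_left_mono) auto
  also have "\<dots> = a"
    using n by (simp add: mult.assoc[symmetric] ennreal_of_nat_eq_real_of_nat ennreal_mult[symmetric])
  finally show ?thesis .
qed

text \<open>Convexity and \<open>\<Phi> 0 = 0\<close> give
  \<open>\<Phi> (t / k) \<le> \<Phi> t / k\<close> for \<open>k \<ge> 1\<close>, so enlarging the
  scale by the size of the modular brings it down to 1.\<close>

lemma orlicz_spaceI:
  assumes [measurable]: "X \<in> borel_measurable M" and c: "0 < c" and fin: "modular M \<Phi> c X < \<infinity>"
  shows "X \<in> orlicz_space M \<Phi>"
proof -
  note [measurable] = \<Phi>_measurable[OF c]
  define k where "k = max 1 (enn2real (modular M \<Phi> c X))"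
  have "modular M \<Phi> c X = ennreal (enn2real (modular M \<Phi> c X))" using fin by simp
  also have "\<dots> \<le> ennreal k" unfolding k_def by (intro ennreal_leI) simp
  finally have k: "1 \<le> k" "modular M \<Phi> c X \<le> ennreal k" by (simp_all add: k_def)
  have "modular M \<Phi> (c * k) X \<le> (\<integral>\<^sup>+ \<omega>. ennreal (1 / k) * ennreal (\<Phi> (\<bar>X \<omega>\<bar> / c)) \<partial>M)"
    unfolding modular_def
  proof (intro nn_integral_mono)
    fix \<omega>
    have "\<Phi> (\<bar>X \<omega>\<bar> / (c * k)) \<le> 1 / k * \<Phi> (\<bar>X \<omega>\<bar> / c)"
      using \<Phi>_scale[of "1 / k" "\<bar>X \<omega>\<bar> / c"] k c by (simp add: mult.commute)
    then show "ennreal (\<Phi> (\<bar>X \<omega>\<bar> / (c * k))) \<le> ennreal (1 / k) * ennreal (\<Phi> (\<bar>X \<omega>\<bar> / c))"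
      using k c by (simp add: ennreal_mult[symmetric] \<Phi>_nonneg ennreal_leI)
  qed
  also have "\<dots> = ennreal (1 / k) * modular M \<Phi> c X"
    unfolding modular_def by (intro nn_integral_cmult) auto
  also have "\<dots> \<le> ennreal (1 / k) * ennreal k"
    using k by (intro mult_left_mono) auto
  also have "\<dots> = 1" using k by (simp add: ennreal_mult[symmetric])
  finally show ?thesis
    using k c by (auto simp: orlicz_space_def modular_def intro!: exI[of _ "c * k"])
qed

lemma orlicz_spaceE:
  assumes "X \<in> orlicz_space M \<Phi>"
  obtains c where "X \<in> borel_measurable M" "0 < c" "modular M \<Phi> c X \<le> 1"
  using assms by (auto simp: orlicz_space_def modular_def)

lemma orlicz_space_measurable: "X \<in> orlicz_space M \<Phi> \<Longrightarrow> X \<in> borel_measurable M"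
  by (simp add: orlicz_space_def)

lemma orlicz_space_abs_add:
  assumes "X \<in> orlicz_space M \<Phi>" "Y \<in> orlicz_space M \<Phi>"
  shows "(\<lambda>\<omega>. \<bar>X \<omega>\<bar> + \<bar>Y \<omega>\<bar>) \<in> orlicz_space M \<Phi>"
proof -
  obtain a where a: "0 < a" "modular M \<Phi> a X \<le> 1" and [measurable]: "X \<in> borel_measurable M"
    using orlicz_spaceE[OF assms(1)] by blast
  obtain b where b: "0 < b" "modular M \<Phi> b Y \<le> 1" and [measurable]: "Y \<in> borel_measurable M"
    using orlicz_spaceE[OF assms(2)] by blast
  have ge: "modular M \<Phi> (max a b) Z \<le> modular M \<Phi> d Z" if "0 < d" "d \<le> max a b" for d Z
    unfolding modular_def using that
    by (intro nn_integral_mono ennreal_leI \<Phi>_mono divide_left_mono) auto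
  have "modular M \<Phi> (2 * max a b) (\<lambda>\<omega>. \<bar>X \<omega>\<bar> + \<bar>Y \<omega>\<bar>) \<le> modular M \<Phi> (max a b) X + modular M \<Phi> (max a b) Y"
    using a by (intro modular_add_le) auto
  also have "\<dots> \<le> 1 + 1"
    using ge[of a X] ge[of b Y] a b by (intro add_mono) (auto intro: order_trans)
  also have "\<dots> < \<infinity>" by simp
  finally show ?thesis using a by (intro orlicz_spaceI[of _ "2 * max a b"]) auto
qed

lemma bounded_in_orlicz_space:
  assumes "X \<in> borel_measurable M" "AE \<omega> in M. \<bar>X \<omega>\<bar> \<le> K"
  shows "X \<in> orlicz_space M \<Phi>"
  using modular_bounded[of 1 X K] assms
  by (intro orlicz_spaceI[of X 1]) (auto intro: le_less_trans)

text \<open>Superlinear growth gives \<open>t \<le> t0 + \<Phi> t\<close> for all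
  \<open>t \<ge> 0\<close>, so a finite modular bounds the first moment.\<close>

lemma orlicz_space_integrable:
  assumes "X \<in> orlicz_space M \<Phi>"
  shows "integrable M X"
proof -
  obtain c where c: "0 < c" "modular M \<Phi> c X \<le> 1" and [measurable]: "X \<in> borel_measurable M"
    using orlicz_spaceE[OF assms] by blast
  note [measurable] = \<Phi>_measurable[OF c(1)]
  obtain t0 where t0: "0 \<le> t0" "\<And>t. t0 \<le> t \<Longrightarrow> 1 * t \<le> \<Phi> t"
    using \<Phi>_dominates_linear[of 1] by blast
  have le: "t \<le> t0 + \<Phi> t" if "0 \<le> t" for t
    using t0 \<Phi>_nonneg[OF that] by (cases "t0 \<le> t") force+
  have "(\<integral>\<^sup>+ \<omega>. ennreal (\<bar>X \<omega>\<bar> / c) \<partial>M) \<le> (\<integral>\<^sup>+ \<omega>. ennreal t0 + ennreal (\<Phi> (\<bar>X \<omega>\<bar> / c)) \<partial>M)"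
    using c t0 le by (intro nn_integral_mono) (simp add: ennreal_plus[symmetric] \<Phi>_nonneg ennreal_leI del: ennreal_plus)
  also have "\<dots> = ennreal t0 + modular M \<Phi> c X"
    unfolding modular_def by (subst nn_integral_add) (auto simp: emeasure_space_1)
  also have "\<dots> \<le> ennreal t0 + 1" using c by (intro add_left_mono) auto
  also have "\<dots> < \<infinity>" by simp
  finally have "integrable M (\<lambda>\<omega>. X \<omega> / c)"
    using c by (intro integrableI_bounded) auto
  then have "integrable M (\<lambda>\<omega>. c * (X \<omega> / c))" by (rule integrable_mult_right)
  then show ?thesis using c by simp
qed

text \<open>Dominated convergence, with the finite modular of \<open>X\<close> at scale
  \<open>c\<close> as bound. Outside the Orlicz heart the tails do not vanish at every
  scale.\<close>

lemma modular_tail_tendsto_0: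
  assumes [measurable]: "X \<in> borel_measurable M" and c: "0 < c" and fin: "modular M \<Phi> c X < \<infinity>"
  shows "(\<lambda>k. modular M \<Phi> c (\<lambda>\<omega>. X \<omega> - clip (real (Suc k)) (X \<omega>))) \<longlonglongrightarrow> 0"
proof -
  note [measurable] = \<Phi>_measurable[OF c]
  have "(\<lambda>k. \<integral>\<^sup>+ \<omega>. ennreal (\<Phi> (\<bar>X \<omega> - clip (real (Suc k)) (X \<omega>)\<bar> / c)) \<partial>M) \<longlonglongrightarrow> (\<integral>\<^sup>+ \<omega>. 0 \<partial>M)"
  proof (rule nn_integral_dominated_convergence[where w = "\<lambda>\<omega>. ennreal (\<Phi> (\<bar>X \<omega>\<bar> / c))"])
    show "AE \<omega> in M. ennreal (\<Phi> (\<bar>X \<omega> - clip (real (Suc k)) (X \<omega>)\<bar> / c)) \<le> ennreal (\<Phi> (\<bar>X \<omega>\<bar> / c))" for k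
      using c by (intro AE_I2 ennreal_leI \<Phi>_mono divide_right_mono abs_diff_clip_le) auto
    show "AE \<omega> in M. (\<lambda>k. ennreal (\<Phi> (\<bar>X \<omega> - clip (real (Suc k)) (X \<omega>)\<bar> / c))) \<longlonglongrightarrow> 0"
    proof (intro AE_I2 tendsto_eventually)
      fix \<omega>
      obtain N where "\<bar>X \<omega>\<bar> \<le> real N" using real_arch_simple[of "\<bar>X \<omega>\<bar>"] ..
      then have "clip (real (Suc k)) (X \<omega>) = X \<omega>" if "N \<le> k" for k
        using that by (intro clip_eq) linarith
      then show "\<forall>\<^sub>F k in sequentially. ennreal (\<Phi> (\<bar>X \<omega> - clip (real (Suc k)) (X \<omega>)\<bar> / c)) = 0"
        by (auto simp: eventually_sequentially intro!: exI[of _ N])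
    qed
    show "(\<integral>\<^sup>+ \<omega>. ennreal (\<Phi> (\<bar>X \<omega>\<bar> / c)) \<partial>M) < \<infinity>"
      using fin unfolding modular_def .
  qed measurable
  then show ?thesis by (simp add: modular_def)
qed

end

section \<open>Conditioning on finite partitions\<close>

text \<open>Conditioning only rescales the mass inside \<open>A\<close>, so a proper piece of
  \<open>A \<inter> B\<close> stays proper. This makes the averaging construction available in each
  cell of a partition.\<close>

lemma (in prob_space) nonatomic_uniform_measure:
  assumes na: "nonatomic M" and A: "A \<in> sets M" "0 < prob A"
  shows "nonatomic (uniform_measure M A)"
  unfolding nonatomic_def
proof (intro ballI impI)
  have eA: "emeasure M A \<noteq> 0" using A by (simp add: emeasure_eq_measure)
  have meas: "measure (uniform_measure M A) B = prob (A \<inter> B) / prob A" if "B \<in> sets M" for B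
    using that eA by (intro measure_uniform_measure) simp_all
  fix B assume "B \<in> sets (uniform_measure M A)" and pos: "0 < measure (uniform_measure M A) B"
  then have B: "B \<in> sets M" by simp
  with pos A have "0 < prob (A \<inter> B)" by (simp add: meas zero_less_divide_iff)
  then obtain C where C: "C \<in> sets M" "C \<subseteq> A \<inter> B" "0 < prob C" "prob C < prob (A \<inter> B)"
    using na A B unfolding nonatomic_def by (meson sets.Int)
  have "A \<inter> C = C" using C by auto
  then have "0 < measure (uniform_measure M A) C \<and> measure (uniform_measure M A) C < measure (uniform_measure M A) B"
    using C A B by (simp add: meas divide_strict_right_mono)
  with C show "\<exists>C\<in>sets (uniform_measure M A). C \<subseteq> B \<and> 0 < measure (uniform_measure M A) C \<and>
      measure (uniform_measure M A) C < measure (uniform_measure M A) B"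
    by auto
qed

lemma integral_uniform_measure:
  fixes f :: "'a \<Rightarrow> real"
  assumes "finite_measure M" and [measurable]: "f \<in> borel_measurable M" and A[measurable]: "A \<in> sets M"
    and pos: "0 < measure M A"
  shows "integral\<^sup>L (uniform_measure M A) f = (\<integral>x. f x * indicator A x \<partial>M) / measure M A"
proof -
  interpret finite_measure M by fact
  have "uniform_measure M A = density M (\<lambda>x. ennreal (indicator A x / measure M A))"
    unfolding uniform_measure_def using pos
    by (intro density_cong) (auto split: split_indicator simp: emeasure_eq_measure divide_ennreal simp flip: ennreal_1)
  then have "integral\<^sup>L (uniform_measure M A) f = (\<integral>x. indicator A x / measure M A * f x \<partial>M)"
    by (simp add: integral_density)
  also have "\<dots> = (\<integral>x. (f x * indicator A x) / measure M A \<partial>M)"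
    by (intro Bochner_Integration.integral_cong) auto
  finally show ?thesis by simp
qed

text \<open>A finite partition is encoded by a measurable labelling \<open>p\<close> of the points by the numbers below \<open>m\<close>.\<close>

locale labelled_prob_space = prob_space M for M :: "'a measure" +
  fixes p :: "'a \<Rightarrow> nat" and m :: nat
  assumes p_measurable[measurable]: "p \<in> measurable M (count_space UNIV)"
    and p_less: "\<And>\<omega>. p \<omega> < m"
begin

definition cell :: "nat \<Rightarrow> 'a set" where
  "cell i = {\<omega>\<in>space M. p \<omega> = i}"

lemma cell_sets[measurable]: "cell i \<in> sets M"
  unfolding cell_def by measurable

definition cond :: "nat \<Rightarrow> 'a measure" where
  "cond i = uniform_measure M (cell i)"

lemma sets_cond[measurable_cong, simp]: "sets (cond i) = sets M"
  and space_cond[simp]: "space (cond i) = space M"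
  by (simp_all add: cond_def)

text \<open>Statements about \<open>cond i\<close> need a cell of positive mass; as there are
  countably many labels, all null cells can be discarded together.\<close>

lemma AE_cell_pos: "AE \<omega> in M. 0 < prob (cell (p \<omega>))"
proof -
  have "AE \<omega> in M. prob (cell i) = 0 \<longrightarrow> \<omega> \<notin> cell i" for i
  proof (cases "prob (cell i) = 0")
    case True
    then have "cell i \<in> null_sets M" by (simp add: null_sets_def emeasure_eq_measure)
    from AE_not_in[OF this] show ?thesis by eventually_elim simp
  qed simp
  then have "AE \<omega> in M. \<forall>i. prob (cell i) = 0 \<longrightarrow> \<omega> \<notin> cell i"
    by (simp add: AE_all_countable)
  then show ?thesis
    by (rule AE_mp) (auto simp: cell_def less_le intro!: AE_I2)
qed

lemma prob_space_cond: "0 < prob (cell i) \<Longrightarrow> prob_space (cond i)"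
  unfolding cond_def by (intro prob_space_uniform_measure) (auto simp: emeasure_eq_measure)

lemma AE_cond_cell: "AE \<omega> in cond i. p \<omega> = i"
  unfolding cond_def by (rule AE_uniform_measureI) (auto simp: cell_def)

text \<open>The law of total expectation. A null cell contributes 0 to both sides, whatever
  \<open>cond i\<close> is.\<close>

lemma nn_integral_cond_sum:
  assumes [measurable]: "g \<in> borel_measurable M"
  shows "(\<integral>\<^sup>+ \<omega>. g \<omega> \<partial>M) = (\<Sum>i<m. emeasure M (cell i) * (\<integral>\<^sup>+ \<omega>. g \<omega> \<partial>cond i))"
proof -
  have "(\<integral>\<^sup>+ \<omega>. g \<omega> \<partial>M) = (\<integral>\<^sup>+ \<omega>. (\<Sum>i<m. g \<omega> * indicator (cell i) \<omega>) \<partial>M)"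
  proof (intro nn_integral_cong)
    fix \<omega> assume "\<omega> \<in> space M"
    then have "(\<Sum>i<m. g \<omega> * indicator (cell i) \<omega>) = (\<Sum>i<m. if i = p \<omega> then g \<omega> else 0)"
      by (intro sum.cong) (auto simp: cell_def)
    then show "g \<omega> = (\<Sum>i<m. g \<omega> * indicator (cell i) \<omega>)"
      using p_less[of \<omega>] by simp
  qed
  also have "\<dots> = (\<Sum>i<m. \<integral>\<^sup>+ \<omega>. g \<omega> * indicator (cell i) \<omega> \<partial>M)"
    by (intro nn_integral_sum) measurable
  also have "\<dots> = (\<Sum>i<m. emeasure M (cell i) * (\<integral>\<^sup>+ \<omega>. g \<omega> \<partial>cond i))"
  proof (intro sum.cong refl)
    fix i
    show "(\<integral>\<^sup>+ \<omega>. g \<omega> * indicator (cell i) \<omega> \<partial>M) = emeasure M (cell i) * (\<integral>\<^sup>+ \<omega>. g \<omega> \<partial>cond i)"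
    proof (cases "emeasure M (cell i) = 0")
      case True
      then have "cell i \<in> null_sets M" by (simp add: null_sets_def)
      from AE_not_in[OF this] have "(\<integral>\<^sup>+ \<omega>. g \<omega> * indicator (cell i) \<omega> \<partial>M) = (\<integral>\<^sup>+ \<omega>. 0 \<partial>M)"
        by (intro nn_integral_cong_AE) (auto elim!: eventually_mono)
      then show ?thesis using True by simp
    next
      case False
      have "(\<integral>\<^sup>+ \<omega>. g \<omega> \<partial>cond i) = (\<integral>\<^sup>+ \<omega>. g \<omega> * indicator (cell i) \<omega> \<partial>M) / emeasure M (cell i)"
        unfolding cond_def by (intro nn_integral_uniform_measure) auto
      then show ?thesis using False
        by (metis ennreal_times_divide mult_divide_eq_ennreal mult.commute emeasure_finite infinity_ennreal_def)
    qed
  qed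
  finally show ?thesis .
qed

text \<open>An explicit version of the conditional expectation given the partition. It depends on
  the label alone, so it is measurable and takes finitely many values for any
  \<open>X\<close>.\<close>

definition cexp :: "('a \<Rightarrow> real) \<Rightarrow> 'a \<Rightarrow> real" where
  "cexp X \<omega> = integral\<^sup>L (cond (p \<omega>)) X"

lemma cexp_measurable[measurable]: "cexp X \<in> borel_measurable M"
  unfolding cexp_def[abs_def] by (rule measurable_compose[OF p_measurable]) simp

lemma cexp_bounded: "\<exists>B. \<forall>\<omega>. \<bar>cexp X \<omega>\<bar> \<le> B"
proof (intro exI allI)
  fix \<omega>
  have "\<bar>integral\<^sup>L (cond (p \<omega>)) X\<bar> \<le> (\<Sum>i<m. \<bar>integral\<^sup>L (cond i) X\<bar>)"
    using p_less[of \<omega>] by (intro member_le_sum) auto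
  then show "\<bar>cexp X \<omega>\<bar> \<le> (\<Sum>i<m. \<bar>integral\<^sup>L (cond i) X\<bar>)"
    by (simp add: cexp_def)
qed

lemma cexp_eq_divide:
  assumes [measurable]: "X \<in> borel_measurable M" and "0 < prob (cell (p \<omega>))"
  shows "cexp X \<omega> = (\<integral>\<omega>'. X \<omega>' * indicator (cell (p \<omega>)) \<omega>' \<partial>M) / prob (cell (p \<omega>))"
  unfolding cexp_def cond_def using assms
  by (intro integral_uniform_measure) (auto intro: finite_measure_axioms)

lemma integrable_cond:
  assumes X: "integrable M X" and "0 < prob (cell i)"
  shows "integrable (cond i) (X :: 'a \<Rightarrow> real)"
proof -
  have [measurable]: "X \<in> borel_measurable M" using X by simp
  have "(\<integral>\<^sup>+ \<omega>. ennreal (norm (X \<omega>)) \<partial>cond i) = (\<integral>\<^sup>+ \<omega>. ennreal (norm (X \<omega>)) * indicator (cell i) \<omega> \<partial>M) / emeasure M (cell i)"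
    unfolding cond_def by (intro nn_integral_uniform_measure) auto
  also have "\<dots> \<le> (\<integral>\<^sup>+ \<omega>. ennreal (norm (X \<omega>)) \<partial>M) / emeasure M (cell i)"
    by (intro divide_right_mono_ennreal nn_integral_mono) (auto split: split_indicator)
  also have "\<dots> < \<infinity>"
    using X assms(2) by (auto simp: integrable_iff_bounded emeasure_eq_measure ennreal_divide_eq_top_iff top.not_eq_extremum[symmetric])
  finally show ?thesis by (intro integrableI_bounded) auto
qed

lemma AE_cexp_add:
  assumes "integrable M X" "integrable M Y"
  shows "AE \<omega> in M. cexp (\<lambda>\<omega>. X \<omega> + Y \<omega>) \<omega> = cexp X \<omega> + cexp Y \<omega>"
  using AE_cell_pos
  by (rule eventually_mono) (auto simp: cexp_def assms intro!: Bochner_Integration.integral_add integrable_cond)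

text \<open>A law is the mixture of the conditional laws on the cells, so rearranging within each
  cell leaves it unchanged.\<close>

lemma glue_equidistributed:
  fixes X :: "'a \<Rightarrow> real" and Y :: "nat \<Rightarrow> 'a \<Rightarrow> real"
  assumes [measurable]: "X \<in> borel_measurable M" "\<And>i. Y i \<in> borel_measurable M"
    and d: "\<And>i. 0 < prob (cell i) \<Longrightarrow> distr (cond i) borel (Y i) = distr (cond i) borel X"
  shows "(\<lambda>\<omega>. Y (p \<omega>) \<omega>) \<in> borel_measurable M"
    and "distr M borel (\<lambda>\<omega>. Y (p \<omega>) \<omega>) = distr M borel X"
proof -
  show m[measurable]: "(\<lambda>\<omega>. Y (p \<omega>) \<omega>) \<in> borel_measurable M"
    by (rule measurable_compose_countable[OF _ p_measurable]) measurable
  have eq: "emeasure (distr N borel Z) B = (\<integral>\<^sup>+ \<omega>. indicator B (Z \<omega>) \<partial>N)"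
    if [measurable]: "Z \<in> borel_measurable N" "B \<in> sets borel" for B :: "real set" and Z :: "'a \<Rightarrow> real" and N
  proof -
    have "(\<integral>\<^sup>+ \<omega>. indicator B (Z \<omega>) \<partial>N) = (\<integral>\<^sup>+ x. indicator B x \<partial>distr N borel Z)"
      by (rule nn_integral_distr[symmetric]) measurable
    also have "\<dots> = emeasure (distr N borel Z) B"
      by (rule nn_integral_indicator) simp
    finally show ?thesis by (rule sym)
  qed
  show "distr M borel (\<lambda>\<omega>. Y (p \<omega>) \<omega>) = distr M borel X"
  proof (rule measure_eqI)
    fix B assume "B \<in> sets (distr M borel (\<lambda>\<omega>. Y (p \<omega>) \<omega>))"
    then have [measurable]: "B \<in> sets borel" by simp
    have "emeasure (distr M borel (\<lambda>\<omega>. Y (p \<omega>) \<omega>)) B = (\<integral>\<^sup>+ \<omega>. indicator B (Y (p \<omega>) \<omega>) \<partial>M)"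
      by (rule eq) measurable
    also have "\<dots> = (\<Sum>i<m. emeasure M (cell i) * (\<integral>\<^sup>+ \<omega>. indicator B (Y (p \<omega>) \<omega>) \<partial>cond i))"
      by (rule nn_integral_cond_sum) measurable
    also have "\<dots> = (\<Sum>i<m. emeasure M (cell i) * (\<integral>\<^sup>+ \<omega>. indicator B (X \<omega>) \<partial>cond i))"
    proof (intro sum.cong refl)
      fix i
      show "emeasure M (cell i) * (\<integral>\<^sup>+ \<omega>. indicator B (Y (p \<omega>) \<omega>) \<partial>cond i)
          = emeasure M (cell i) * (\<integral>\<^sup>+ \<omega>. indicator B (X \<omega>) \<partial>cond i)"
      proof (cases "prob (cell i) = 0")
        case False
        then have "0 < prob (cell i)" by (simp add: less_le)
        note d = d[OF this]
        have "(\<integral>\<^sup>+ \<omega>. indicator B (Y (p \<omega>) \<omega>) \<partial>cond i) = (\<integral>\<^sup>+ \<omega>. indicator B (Y i \<omega>) \<partial>cond i)"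
          using AE_cond_cell[of i] by (intro nn_integral_cong_AE) (auto elim!: eventually_mono)
        also have "\<dots> = (\<integral>\<^sup>+ \<omega>. indicator B (X \<omega>) \<partial>cond i)"
          using d by (simp add: eq[symmetric])
        finally show ?thesis by simp
      qed (simp add: emeasure_eq_measure)
    qed
    also have "\<dots> = (\<integral>\<^sup>+ \<omega>. indicator B (X \<omega>) \<partial>M)"
      by (rule nn_integral_cond_sum[symmetric]) measurable
    also have "\<dots> = emeasure (distr M borel X) B"
      by (rule eq[symmetric]) measurable
    finally show "emeasure (distr M borel (\<lambda>\<omega>. Y (p \<omega>) \<omega>)) B = emeasure (distr M borel X) B" .
  qed simp
qed

text \<open>The averaging construction is carried out in each cell under its conditional measure,
  and the copies are glued along the labels.\<close>

lemma equidistributed_average_cexp: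
  fixes X :: "'a \<Rightarrow> real" and n :: nat
  assumes na: "nonatomic M" and X[measurable]: "X \<in> borel_measurable M" and n: "0 < n"
  shows "\<exists>Y. (\<forall>j<n. Y j \<in> borel_measurable M \<and> distr M borel (Y j) = distr M borel X) \<and>
    (\<forall>K\<ge>0. AE \<omega> in M. \<bar>(\<Sum>j<n. clip K (Y j \<omega>)) / n - cexp (\<lambda>\<omega>. clip K (X \<omega>)) \<omega>\<bar> \<le> 4 * K / n)"
proof -
  \<comment> \<open>On a null cell only measurability is demanded, which \<open>X\<close> itself
    meets; so a family exists for every label, as gluing requires.\<close>
  define good where "good i Y \<longleftrightarrow> (\<forall>j. Y j \<in> borel_measurable M \<and>
        (0 < prob (cell i) \<longrightarrow> j < n \<longrightarrow> distr (cond i) borel (Y j) = distr (cond i) borel X)) \<and>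
    (0 < prob (cell i) \<longrightarrow> (\<forall>K\<ge>0. \<forall>\<omega>. \<bar>(\<Sum>j<n. clip K (Y j \<omega>)) / n - integral\<^sup>L (cond i) (\<lambda>\<omega>. clip K (X \<omega>))\<bar> \<le> 4 * K / n))"
    for i and Y :: "nat \<Rightarrow> 'a \<Rightarrow> real"
  have "\<exists>Y :: nat \<Rightarrow> 'a \<Rightarrow> real. good i Y" for i :: nat
  proof (cases "0 < prob (cell i)")
    case True
    interpret c: prob_space "cond i" using True by (rule prob_space_cond)
    have "nonatomic (cond i)"
      unfolding cond_def using na True by (intro nonatomic_uniform_measure) auto
    from c.nonatomic_equidistributed_average[OF this _ n, of X]
    obtain Y where Y: "\<And>j. Y j \<in> borel_measurable (cond i)"
       "\<And>j. j < n \<Longrightarrow> distr (cond i) borel (Y j) = distr (cond i) borel X"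
       "\<And>K \<omega>. 0 \<le> K \<Longrightarrow> \<bar>(\<Sum>j<n. clip K (Y j \<omega>)) / n - integral\<^sup>L (cond i) (\<lambda>\<omega>. clip K (X \<omega>))\<bar> \<le> 4 * K / n"
      by (auto simp: measurable_cong_sets[OF sets_cond refl])
    have "Y j \<in> borel_measurable M" for j
      using Y(1)[of j] by (simp add: measurable_cong_sets[OF sets_cond refl])
    then have "good i Y" unfolding good_def using Y(2,3) by blast
    then show ?thesis by (rule exI[of _ Y])
  next
    case False
    then have "good i (\<lambda>_. X)" by (simp add: good_def)
    then show ?thesis by (rule exI[of _ "\<lambda>_. X"])
  qed
  then obtain Y where Y: "\<And>i. good i (Y i)" by metis
  have Ym: "Y i j \<in> borel_measurable M" for i j using Y[of i] by (auto simp: good_def)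
  define Z where "Z j \<omega> = Y (p \<omega>) j \<omega>" for j \<omega>
  have "Z j \<in> borel_measurable M \<and> distr M borel (Z j) = distr M borel X" if "j < n" for j
    using glue_equidistributed[of X "\<lambda>i. Y i j"] Ym Y that unfolding Z_def[abs_def] by (auto simp: good_def)
  moreover have "AE \<omega> in M. \<bar>(\<Sum>j<n. clip K (Z j \<omega>)) / n - cexp (\<lambda>\<omega>. clip K (X \<omega>)) \<omega>\<bar> \<le> 4 * K / n" if "0 \<le> K" for K
    using AE_cell_pos by (rule eventually_mono) (use Y that in \<open>simp add: good_def Z_def cexp_def\<close>)
  ultimately show ?thesis by blast
qed

end

section \<open>Jensen's inequality for conditional means\<close>

context orlicz_prob_space
begin

text \<open>Jensen's inequality in every cell of positive mass, weighted by the masses. Finiteness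
  of the right-hand side supplies the integrability it demands; otherwise the bound is
  trivial.\<close>

lemma modular_cexp_le:
  assumes "labelled_prob_space M p m" and T: "integrable M T" and c: "0 < c"
  shows "modular M \<Phi> c (labelled_prob_space.cexp M p T) \<le> modular M \<Phi> c T"
proof (cases "modular M \<Phi> c T = \<infinity>")
  case False
  interpret labelled_prob_space M p m by fact
  note [measurable] = \<Phi>_measurable[OF c]
  have [measurable]: "T \<in> borel_measurable M" using T by simp
  have T2: "integrable M (\<lambda>\<omega>. \<Phi> (\<bar>T \<omega>\<bar> / c))"
    using False c by (intro integrableI_bounded) (auto simp: modular_def \<Phi>_nonneg top.not_eq_extremum)
  have jensen: "(\<integral>\<^sup>+ \<omega>. ennreal (\<Phi> (\<bar>cexp T \<omega>\<bar> / c)) \<partial>cond i) \<le> (\<integral>\<^sup>+ \<omega>. ennreal (\<Phi> (\<bar>T \<omega>\<bar> / c)) \<partial>cond i)"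
    if i: "0 < prob (cell i)" for i
  proof -
    interpret c: prob_space "cond i" using i by (rule prob_space_cond)
    have "(\<integral>\<^sup>+ \<omega>. ennreal (\<Phi> (\<bar>cexp T \<omega>\<bar> / c)) \<partial>cond i) = (\<integral>\<^sup>+ \<omega>. ennreal (\<Phi> (\<bar>integral\<^sup>L (cond i) T\<bar> / c)) \<partial>cond i)"
      using AE_cond_cell[of i] by (intro nn_integral_cong_AE) (auto elim!: eventually_mono simp: cexp_def)
    also have "\<dots> = ennreal (\<Phi> (\<bar>integral\<^sup>L (cond i) T\<bar> / c))"
      by (simp add: c.emeasure_space_1 del: space_cond)
    also have "\<dots> \<le> ennreal (\<integral>\<omega>. \<Phi> (\<bar>T \<omega>\<bar> / c) \<partial>cond i)"
      using c.jensens_inequality[where I=UNIV and q="\<lambda>x. \<Phi> (\<bar>x\<bar> / c)", OF integrable_cond[OF T i] _ _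
          integrable_cond[OF T2 i] convex_on_orlicz_abs[OF orlicz c]]
      by (intro ennreal_leI) simp
    also have "\<dots> = (\<integral>\<^sup>+ \<omega>. ennreal (\<Phi> (\<bar>T \<omega>\<bar> / c)) \<partial>cond i)"
      using c by (intro nn_integral_eq_integral[symmetric] integrable_cond[OF T2 i]) (simp add: \<Phi>_nonneg)
    finally show ?thesis .
  qed
  have "modular M \<Phi> c (cexp T) = (\<Sum>i<m. emeasure M (cell i) * (\<integral>\<^sup>+ \<omega>. ennreal (\<Phi> (\<bar>cexp T \<omega>\<bar> / c)) \<partial>cond i))"
    unfolding modular_def by (rule nn_integral_cond_sum) measurable
  also have "\<dots> \<le> (\<Sum>i<m. emeasure M (cell i) * (\<integral>\<^sup>+ \<omega>. ennreal (\<Phi> (\<bar>T \<omega>\<bar> / c)) \<partial>cond i))"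
  proof (intro sum_mono)
    fix i
    show "emeasure M (cell i) * (\<integral>\<^sup>+ \<omega>. ennreal (\<Phi> (\<bar>cexp T \<omega>\<bar> / c)) \<partial>cond i)
      \<le> emeasure M (cell i) * (\<integral>\<^sup>+ \<omega>. ennreal (\<Phi> (\<bar>T \<omega>\<bar> / c)) \<partial>cond i)"
    proof (cases "prob (cell i) = 0")
      case True
      then show ?thesis by (simp add: emeasure_eq_measure)
    next
      case False
      then show ?thesis by (intro mult_left_mono jensen) (simp_all add: less_le)
    qed
  qed
  also have "\<dots> = modular M \<Phi> c T"
    unfolding modular_def by (rule nn_integral_cond_sum[symmetric]) measurable
  finally show ?thesis .
qed simp

end

section \<open>Law-invariant convex sets closed under dominated limits\<close>

context orlicz_prob_space
begin

text \<open>Without a \<open>\<Delta>\<^sub>2\<close> condition only the scale \<open>c\<close> is controlled; the supremum of the sequence,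
  which need not be attained, is estimated at the scale \<open>2 * c\<close>.\<close>

lemma modular_tendsto_0_imp_AE_tendsto:
  assumes c: "0 < c" and D: "\<And>n. D n \<in> borel_measurable M"
    and le: "\<And>n. modular M \<Phi> c (D n) \<le> ennreal ((1/2) ^ Suc n)"
  shows "AE \<omega> in M. (\<lambda>n. D n \<omega>) \<longlonglongrightarrow> 0"
    and "\<exists>W\<in>orlicz_space M \<Phi>. AE \<omega> in M. \<forall>n. \<bar>D n \<omega>\<bar> \<le> W \<omega>"
proof -
  note [measurable] = \<Phi>_measurable[OF c] D
  \<comment> \<open>The bounds on the modulars sum to 1, so \<open>S\<close> is almost surely finite
    and controls all terms at once.\<close>
  define S where "S \<omega> = (\<Sum>n. ennreal (\<Phi> (\<bar>D n \<omega>\<bar> / c)))" for \<omega>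
  have Sm[measurable]: "S \<in> borel_measurable M" unfolding S_def[abs_def] by measurable
  have "(\<integral>\<^sup>+ \<omega>. S \<omega> \<partial>M) = (\<Sum>n. modular M \<Phi> c (D n))"
    unfolding S_def modular_def by (intro nn_integral_suminf) measurable
  also have "\<dots> \<le> (\<Sum>n. ennreal ((1/2) ^ Suc n))"
    using le by (intro suminf_le) auto
  also have "\<dots> = ennreal 1"
    by (rule suminf_ennreal_eq[OF _ power_half_series]) simp
  finally have S1: "(\<integral>\<^sup>+ \<omega>. S \<omega> \<partial>M) \<le> 1" by simp
  then have "(\<integral>\<^sup>+ \<omega>. S \<omega> \<partial>M) \<noteq> \<infinity>" by (auto simp: top_unique)
  then have fin: "AE \<omega> in M. S \<omega> \<noteq> \<infinity>" by (intro nn_integral_PInf_AE) auto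
  have summand_le: "ennreal (\<Phi> (\<bar>D n \<omega>\<bar> / c)) \<le> S \<omega>" for n \<omega>
    unfolding S_def using sum_le_suminf[OF summableI, of "{n}" "\<lambda>n. ennreal (\<Phi> (\<bar>D n \<omega>\<bar> / c))"] by simp
  have conv: "(\<lambda>n. D n \<omega>) \<longlonglongrightarrow> 0" if "S \<omega> \<noteq> \<infinity>" for \<omega>
  proof (rule LIMSEQ_I)
    fix e :: real assume e: "0 < e"
    have "summable (\<lambda>n. \<Phi> (\<bar>D n \<omega>\<bar> / c))"
      using that c unfolding S_def
      by (intro summable_suminf_not_top) (auto simp: \<Phi>_nonneg)
    then have "(\<lambda>n. \<Phi> (\<bar>D n \<omega>\<bar> / c)) \<longlonglongrightarrow> 0" by (rule summable_LIMSEQ_zero)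
    \<comment> \<open>Strict positivity of \<open>\<Phi>\<close> away from 0 turns smallness of its
      values into smallness of \<open>D n \<omega>\<close>.\<close>
    moreover have "0 < \<Phi> (e / c)" using e c by (intro pos) simp
    ultimately have "\<forall>\<^sub>F n in sequentially. \<Phi> (\<bar>D n \<omega>\<bar> / c) < \<Phi> (e / c)"
      by (rule order_tendstoD(2))
    then have "\<forall>\<^sub>F n in sequentially. \<bar>D n \<omega>\<bar> < e"
    proof (rule eventually_mono)
      fix n assume *: "\<Phi> (\<bar>D n \<omega>\<bar> / c) < \<Phi> (e / c)"
      show "\<bar>D n \<omega>\<bar> < e"
      proof (rule ccontr)
        assume "\<not> \<bar>D n \<omega>\<bar> < e"
        then have "\<Phi> (e / c) \<le> \<Phi> (\<bar>D n \<omega>\<bar> / c)"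
          using e c by (intro \<Phi>_mono divide_right_mono) auto
        with * show False by simp
      qed
    qed
    then show "\<exists>N. \<forall>n\<ge>N. norm (D n \<omega> - 0) < e" by (simp add: eventually_sequentially)
  qed
  show "AE \<omega> in M. (\<lambda>n. D n \<omega>) \<longlonglongrightarrow> 0"
    using fin conv by (rule eventually_mono)
  define G where "G \<omega> = (SUP n. ennreal \<bar>D n \<omega>\<bar>)" for \<omega>
  have [measurable]: "G \<in> borel_measurable M" unfolding G_def[abs_def] by measurable
  define W where "W \<omega> = enn2real (G \<omega>)" for \<omega>
  have [measurable]: "W \<in> borel_measurable M" unfolding W_def[abs_def] by measurable
  have WG: "ennreal (W \<omega>) = G \<omega>" if "S \<omega> \<noteq> \<infinity>" for \<omega>
  proof -
    from conv[OF that] have "Bseq (\<lambda>n. D n \<omega>)"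
      by (intro convergent_imp_Bseq) (auto simp: convergent_def)
    then obtain K where "\<And>n. \<bar>D n \<omega>\<bar> \<le> K" by (auto simp: Bseq_def)
    then have "G \<omega> \<le> ennreal K" unfolding G_def by (intro SUP_least ennreal_leI)
    then have "G \<omega> < \<infinity>" by (rule le_less_trans) simp
    then show ?thesis by (simp add: W_def)
  qed
  have dom: "AE \<omega> in M. \<forall>n. \<bar>D n \<omega>\<bar> \<le> W \<omega>"
    using fin
  proof (rule eventually_mono, intro allI)
    fix \<omega> n assume "S \<omega> \<noteq> \<infinity>"
    have "ennreal \<bar>D n \<omega>\<bar> \<le> G \<omega>" unfolding G_def by (rule SUP_upper) simp
    with WG[OF \<open>S \<omega> \<noteq> \<infinity>\<close>] have "ennreal \<bar>D n \<omega>\<bar> \<le> ennreal (W \<omega>)" by simp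
    then show "\<bar>D n \<omega>\<bar> \<le> W \<omega>" by (simp add: W_def ennreal_le_iff)
  qed
  have "AE \<omega> in M. ennreal (\<Phi> (\<bar>W \<omega>\<bar> / (2 * c))) \<le> S \<omega>"
    using fin
  proof (rule eventually_mono)
    fix \<omega> assume S: "S \<omega> \<noteq> \<infinity>"
    have W0: "0 \<le> W \<omega>" by (simp add: W_def)
    show "ennreal (\<Phi> (\<bar>W \<omega>\<bar> / (2 * c))) \<le> S \<omega>"
    proof (cases "W \<omega> = 0")
      case False
      \<comment> \<open>A positive supremum exceeds its own half, so some term does too; this term
        gives the estimate at the doubled scale.\<close>
      with W0 have "ennreal (W \<omega> / 2) < ennreal (W \<omega>)" by (simp add: ennreal_less_iff)
      then have "ennreal (W \<omega> / 2) < (SUP n. ennreal \<bar>D n \<omega>\<bar>)" using WG[OF S] by (simp add: G_def)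
      then obtain n where "ennreal (W \<omega> / 2) < ennreal \<bar>D n \<omega>\<bar>" by (auto simp: less_SUP_iff)
      then have "W \<omega> / 2 < \<bar>D n \<omega>\<bar>" using W0 by (simp add: ennreal_less_iff)
      then have "W \<omega> / 2 / c \<le> \<bar>D n \<omega>\<bar> / c" using c by (intro divide_right_mono) auto
      then have "\<Phi> (\<bar>W \<omega>\<bar> / (2 * c)) \<le> \<Phi> (\<bar>D n \<omega>\<bar> / c)"
        using W0 c by (intro \<Phi>_mono) simp_all
      then have "ennreal (\<Phi> (\<bar>W \<omega>\<bar> / (2 * c))) \<le> ennreal (\<Phi> (\<bar>D n \<omega>\<bar> / c))" by (rule ennreal_leI)
      then show ?thesis using summand_le[of n \<omega>] by (rule order_trans)
    qed simp
  qed
  then have "modular M \<Phi> (2 * c) W \<le> (\<integral>\<^sup>+ \<omega>. S \<omega> \<partial>M)"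
    unfolding modular_def by (rule nn_integral_mono_AE)
  also note S1
  also have "1 < (\<infinity> :: ennreal)" by simp
  finally have "W \<in> orlicz_space M \<Phi>" using c by (intro orlicz_spaceI[of W "2 * c"]) auto
  with dom show "\<exists>W\<in>orlicz_space M \<Phi>. AE \<omega> in M. \<forall>n. \<bar>D n \<omega>\<bar> \<le> W \<omega>" by blast
qed

end

text \<open>Abstracts the sublevel sets of a quasiconvex law-invariant functional with the Fatou property.\<close>

locale fatou_closed_set = orlicz_prob_space +
  fixes C :: "('a \<Rightarrow> real) set"
  assumes nonatomic: "nonatomic M"
    and C_subset: "C \<subseteq> orlicz_space M \<Phi>"
    and C_convex: "\<And>X Y t. X \<in> C \<Longrightarrow> Y \<in> C \<Longrightarrow> 0 \<le> t \<Longrightarrow> t \<le> 1 \<Longrightarrow> (\<lambda>\<omega>. t * X \<omega> + (1 - t) * Y \<omega>) \<in> C"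
    and C_law: "\<And>X Y. X \<in> C \<Longrightarrow> Y \<in> orlicz_space M \<Phi> \<Longrightarrow> distr M borel X = distr M borel Y \<Longrightarrow> Y \<in> C"
    and C_fatou: "\<And>Xs X Y. (\<And>n. Xs n \<in> C) \<Longrightarrow> X \<in> orlicz_space M \<Phi> \<Longrightarrow> Y \<in> orlicz_space M \<Phi> \<Longrightarrow>
      (AE \<omega> in M. (\<lambda>n. Xs n \<omega>) \<longlonglongrightarrow> X \<omega>) \<Longrightarrow> (\<And>n. AE \<omega> in M. \<bar>Xs n \<omega>\<bar> \<le> Y \<omega>) \<Longrightarrow> X \<in> C"
begin

text \<open>Elements whose modular distance to \<open>Z\<close> decreases geometrically converge
  almost surely and are dominated by \<open>\<bar>Z \<omega>\<bar> + \<bar>W \<omega>\<bar>\<close>,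
  so closedness under dominated limits applies.\<close>

lemma C_modular_closed:
  assumes Z: "Z \<in> orlicz_space M \<Phi>" and Zs: "\<And>n. Zs n \<in> C" and c: "0 < c"
    and lim: "(\<lambda>n. modular M \<Phi> c (\<lambda>\<omega>. Zs n \<omega> - Z \<omega>)) \<longlonglongrightarrow> 0"
  shows "Z \<in> C"
proof -
  have "\<exists>k. modular M \<Phi> c (\<lambda>\<omega>. Zs k \<omega> - Z \<omega>) \<le> ennreal ((1/2) ^ Suc n)" for n
  proof -
    have "\<forall>\<^sub>F k in sequentially. modular M \<Phi> c (\<lambda>\<omega>. Zs k \<omega> - Z \<omega>) < ennreal ((1/2) ^ Suc n)"
      by (rule order_tendstoD(2)[OF lim]) simp
    then show ?thesis by (auto simp: eventually_sequentially intro: less_imp_le)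
  qed
  then obtain r where r: "\<And>n. modular M \<Phi> c (\<lambda>\<omega>. Zs (r n) \<omega> - Z \<omega>) \<le> ennreal ((1/2) ^ Suc n)" by metis
  define D where "D n \<omega> = Zs (r n) \<omega> - Z \<omega>" for n \<omega>
  have ZsL: "Zs n \<in> orlicz_space M \<Phi>" for n using Zs C_subset by blast
  have Dm: "D n \<in> borel_measurable M" for n
    unfolding D_def[abs_def] using orlicz_space_measurable[OF Z] orlicz_space_measurable[OF ZsL] by measurable
  note D = modular_tendsto_0_imp_AE_tendsto[OF c Dm r[folded D_def]]
  obtain W where W: "W \<in> orlicz_space M \<Phi>" and dom: "AE \<omega> in M. \<forall>n. \<bar>D n \<omega>\<bar> \<le> W \<omega>" using D(2) by blast
  show ?thesis
  proof (rule C_fatou[of "\<lambda>n. Zs (r n)"])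
    show "(\<lambda>\<omega>. \<bar>Z \<omega>\<bar> + \<bar>W \<omega>\<bar>) \<in> orlicz_space M \<Phi>" using Z W by (rule orlicz_space_abs_add)
    show "AE \<omega> in M. (\<lambda>n. Zs (r n) \<omega>) \<longlonglongrightarrow> Z \<omega>"
      using D(1) by (rule eventually_mono) (simp add: D_def LIM_zero_iff)
    show "AE \<omega> in M. \<bar>Zs (r n) \<omega>\<bar> \<le> \<bar>Z \<omega>\<bar> + \<bar>W \<omega>\<bar>" for n
      using dom
    proof (rule eventually_mono)
      fix \<omega> assume "\<forall>n. \<bar>D n \<omega>\<bar> \<le> W \<omega>"
      then have "\<bar>D n \<omega>\<bar> \<le> W \<omega>" ..
      then show "\<bar>Zs (r n) \<omega>\<bar> \<le> \<bar>Z \<omega>\<bar> + \<bar>W \<omega>\<bar>" unfolding D_def by linarith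
    qed
  qed (use Zs Z in auto)
qed

text \<open>The common frame of the two limit arguments below: a uniformly small error plus two
  remainders small in modular. Separating three terms doubles the scale twice.\<close>

lemma C_approximation:
  assumes Z: "Z \<in> orlicz_space M \<Phi>" and Zs: "\<And>n. Zs n \<in> C" and c: "0 < c"
    and b[measurable]: "\<And>n. b n \<in> borel_measurable M" and d[measurable]: "\<And>n. d n \<in> borel_measurable M"
    and \<delta>: "\<And>n. 0 \<le> \<delta> n" "\<delta> \<longlonglongrightarrow> 0"
    and le: "\<And>n. AE \<omega> in M. \<bar>Zs n \<omega> - Z \<omega>\<bar> \<le> \<delta> n + \<bar>b n \<omega>\<bar> + \<bar>d n \<omega>\<bar>"
    and \<tau>: "\<And>n. modular M \<Phi> c (b n) \<le> \<tau> n" "\<And>n. modular M \<Phi> c (d n) \<le> \<tau> n" "\<tau> \<longlonglongrightarrow> 0"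
  shows "Z \<in> C"
proof (rule C_modular_closed[OF Z Zs, of "2 * (2 * c)"])
  have bound: "modular M \<Phi> (2 * (2 * c)) (\<lambda>\<omega>. Zs n \<omega> - Z \<omega>) \<le> ennreal (\<Phi> (\<delta> n / (2 * c))) + (\<tau> n + \<tau> n)" for n
  proof -
    have "modular M \<Phi> (2 * (2 * c)) (\<lambda>\<omega>. Zs n \<omega> - Z \<omega>)
        \<le> modular M \<Phi> (2 * (2 * c)) (\<lambda>\<omega>. \<bar>\<delta> n\<bar> + \<bar>\<bar>b n \<omega>\<bar> + \<bar>d n \<omega>\<bar>\<bar>)"
      using c \<delta>(1)[of n] by (intro modular_mono_AE eventually_mono[OF le[of n]]) auto
    also have "\<dots> \<le> modular M \<Phi> (2 * c) (\<lambda>\<omega>. \<delta> n) + modular M \<Phi> (2 * c) (\<lambda>\<omega>. \<bar>b n \<omega>\<bar> + \<bar>d n \<omega>\<bar>)"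
      using c by (intro modular_add_le) auto
    also have "\<dots> \<le> ennreal (\<Phi> (\<delta> n / (2 * c))) + (modular M \<Phi> c (b n) + modular M \<Phi> c (d n))"
      using c \<delta>(1)[of n] by (intro add_mono modular_bounded modular_add_le) auto
    also have "\<dots> \<le> ennreal (\<Phi> (\<delta> n / (2 * c))) + (\<tau> n + \<tau> n)"
      by (intro add_mono order_refl \<tau>)
    finally show ?thesis .
  qed
  \<comment> \<open>Continuity of \<open>\<Phi>\<close> at 0 comes from convexity, which bounds it
    linearly once \<open>\<delta> n < 1\<close>.\<close>
  have "(\<lambda>n. \<Phi> (\<delta> n / (2 * c))) \<longlonglongrightarrow> 0"
  proof (rule tendsto_sandwich)
    show "\<forall>\<^sub>F n in sequentially. 0 \<le> \<Phi> (\<delta> n / (2 * c))"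
      using \<delta>(1) c by (intro always_eventually allI \<Phi>_nonneg) simp
    have "\<forall>\<^sub>F n in sequentially. \<delta> n < 1" by (rule order_tendstoD(2)[OF \<delta>(2)]) simp
    then show "\<forall>\<^sub>F n in sequentially. \<Phi> (\<delta> n / (2 * c)) \<le> \<delta> n * \<Phi> (1 / (2 * c))"
    proof (rule eventually_mono)
      fix n assume "\<delta> n < 1"
      then show "\<Phi> (\<delta> n / (2 * c)) \<le> \<delta> n * \<Phi> (1 / (2 * c))"
        using \<Phi>_scale[of "\<delta> n" "1 / (2 * c)"] \<delta>(1)[of n] c by simp
    qed
    show "(\<lambda>n. \<delta> n * \<Phi> (1 / (2 * c))) \<longlonglongrightarrow> 0"
      using tendsto_mult_left_zero[OF \<delta>(2)] by simp
  qed simp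
  from tendsto_add[OF tendsto_ennrealI[OF this] tendsto_add[OF \<tau>(3) \<tau>(3)]]
  have lim: "(\<lambda>n. ennreal (\<Phi> (\<delta> n / (2 * c))) + (\<tau> n + \<tau> n)) \<longlonglongrightarrow> 0"
    by simp
  show "(\<lambda>n. modular M \<Phi> (2 * (2 * c)) (\<lambda>\<omega>. Zs n \<omega> - Z \<omega>)) \<longlonglongrightarrow> 0"
    by (rule tendsto_sandwich[OF always_eventually always_eventually tendsto_const lim])
       (intro allI zero_le, intro allI bound)
qed (use c in simp)

lemma C_average:
  assumes "0 < n" "\<And>j. j < n \<Longrightarrow> f j \<in> C"
  shows "(\<lambda>\<omega>. (\<Sum>j<n. f j \<omega>) / real n) \<in> C"
  using assms
proof (induction n)
  case (Suc n)
  show ?case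
  proof (cases "n = 0")
    case True
    then show ?thesis using Suc.prems by simp
  next
    case False
    \<comment> \<open>This weight updates the mean of \<open>n\<close> terms to the mean of
      \<open>n + 1\<close> terms.\<close>
    define t where "t = real n / real (Suc n)"
    have "(\<lambda>\<omega>. t * ((\<Sum>j<n. f j \<omega>) / real n) + (1 - t) * f n \<omega>) \<in> C"
      using Suc False by (intro C_convex) (auto simp: t_def)
    moreover have "t * ((\<Sum>j<n. f j \<omega>) / real n) + (1 - t) * f n \<omega> = (\<Sum>j<Suc n. f j \<omega>) / real (Suc n)" for \<omega>
    proof -
      have "1 - t = 1 / real (Suc n)" by (simp add: t_def field_simps)
      then show ?thesis using False by (simp add: t_def add_divide_distrib)
    qed
    ultimately show ?thesis by simp
  qed
qed simp

text \<open>Averages of copies of \<open>X\<close> rearranged within the cells approximate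
  \<open>cexp X\<close>: their truncated parts are uniformly close to the conditional mean of the
  truncation. The tails enter averaged over the copies in \<open>b\<close> and through their
  conditional mean in \<open>d\<close>, with modulars at most that of the tail of
  \<open>X\<close>.\<close>

lemma C_cexp:
  assumes X: "X \<in> C" and p: "labelled_prob_space M p m"
  shows "labelled_prob_space.cexp M p X \<in> C"
proof -
  interpret labelled_prob_space M p m by fact
  have XL: "X \<in> orlicz_space M \<Phi>" using X C_subset by blast
  obtain c where c: "0 < c" "modular M \<Phi> c X \<le> 1" and Xm[measurable]: "X \<in> borel_measurable M"
    using orlicz_spaceE[OF XL] by blast
  have Xi: "integrable M X" by (rule orlicz_space_integrable[OF XL])
  define K where "K k = real (Suc k)" for k
  \<comment> \<open>With this many copies the uniform error \<open>4 * K k / n k\<close> is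
    \<open>1 / real (Suc k)\<close>, although the truncation level grows.\<close>
  define n where "n k = 4 * (Suc k) ^ 2" for k :: nat
  define \<tau> where "\<tau> k = modular M \<Phi> c (\<lambda>\<omega>. X \<omega> - clip (K k) (X \<omega>))" for k
  have K0: "0 \<le> K k" for k by (simp add: K_def)
  have n0: "0 < n k" for k by (simp add: n_def)
  define copies where "copies k Y \<longleftrightarrow> (\<forall>j<n k. Y j \<in> borel_measurable M \<and> distr M borel (Y j) = distr M borel X) \<and>
    (AE \<omega> in M. \<bar>(\<Sum>j<n k. clip (K k) (Y j \<omega>)) / n k - cexp (\<lambda>\<omega>. clip (K k) (X \<omega>)) \<omega>\<bar> \<le> 4 * K k / n k)"
    for k and Y :: "nat \<Rightarrow> 'a \<Rightarrow> real"
  have "\<exists>Y. copies k Y" for k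
  proof -
    obtain Y where Y: "(\<forall>j<n k. Y j \<in> borel_measurable M \<and> distr M borel (Y j) = distr M borel X) \<and>
      (\<forall>K\<ge>0. AE \<omega> in M. \<bar>(\<Sum>j<n k. clip K (Y j \<omega>)) / n k - cexp (\<lambda>\<omega>. clip K (X \<omega>)) \<omega>\<bar> \<le> 4 * K / n k)"
      using equidistributed_average_cexp[OF nonatomic Xm n0[of k]] ..
    have "copies k Y"
      unfolding copies_def using conjunct1[OF Y] conjunct2[OF Y, rule_format, OF K0[of k]] by (rule conjI)
    then show ?thesis by (rule exI[of _ Y])
  qed
  then obtain Y where Y: "\<And>k. copies k (Y k)" by metis
  have Ym: "Y k j \<in> borel_measurable M" and Yd: "distr M borel (Y k j) = distr M borel X" if "j < n k" for k j
    using conjunct1[OF Y[of k, unfolded copies_def]] that by simp_all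
  have Ya: "AE \<omega> in M. \<bar>(\<Sum>j<n k. clip (K k) (Y k j \<omega>)) / n k - cexp (\<lambda>\<omega>. clip (K k) (X \<omega>)) \<omega>\<bar> \<le> 4 * K k / n k" for k
    by (rule conjunct2[OF Y[of k, unfolded copies_def]])
  define b where "b k \<omega> = (\<Sum>j<n k. Y k j \<omega> - clip (K k) (Y k j \<omega>)) / real (n k)" for k \<omega>
  define d where "d k = cexp (\<lambda>\<omega>. X \<omega> - clip (K k) (X \<omega>))" for k
  \<comment> \<open>Law invariance of \<open>C\<close> concerns elements of the Orlicz space; the
    copies belong to it because the modular depends only on the law.\<close>
  have YC: "Y k j \<in> C" if "j < n k" for k j
  proof (rule C_law[OF X])
    have "modular M \<Phi> c (Y k j) = modular M \<Phi> c X"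
      using modular_distr[OF c(1) Ym[OF that] Xm Yd[OF that], of "\<lambda>x. x"] by simp
    then show "Y k j \<in> orlicz_space M \<Phi>"
      using c Ym[OF that] by (intro orlicz_spaceI[of _ c]) (auto intro: le_less_trans)
  qed (simp add: Yd[OF that])
  have clip_int: "integrable M (\<lambda>\<omega>. clip (K k) (X \<omega>))" for k
    using abs_clip_le[OF K0[of k]] by (intro integrable_const_bound[of _ "K k"]) auto
  show ?thesis
  proof (rule C_approximation[where Zs = "\<lambda>k \<omega>. (\<Sum>j<n k. Y k j \<omega>) / real (n k)" and b = b and d = d
        and \<delta> = "\<lambda>k. 1 / real (Suc k)" and \<tau> = \<tau> and c = c])
    obtain B where "\<And>\<omega>. \<bar>cexp X \<omega>\<bar> \<le> B" using cexp_bounded[of X] by blast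
    then show "cexp X \<in> orlicz_space M \<Phi>" by (intro bounded_in_orlicz_space[of _ B]) auto
    show "(\<lambda>\<omega>. (\<Sum>j<n k. Y k j \<omega>) / real (n k)) \<in> C" for k
      by (rule C_average[OF n0 YC])
    show "b k \<in> borel_measurable M" for k
      unfolding b_def[abs_def] using Ym by (intro borel_measurable_divide borel_measurable_sum borel_measurable_diff)
        (auto intro: measurable_compose[OF _ clip_measurable])
    show "d k \<in> borel_measurable M" for k unfolding d_def by measurable
    show "(\<lambda>k. 1 / real (Suc k)) \<longlonglongrightarrow> 0" using LIMSEQ_inverse_real_of_nat by (simp add: inverse_eq_divide)
    show "AE \<omega> in M. \<bar>(\<Sum>j<n k. Y k j \<omega>) / real (n k) - cexp X \<omega>\<bar> \<le> 1 / real (Suc k) + \<bar>b k \<omega>\<bar> + \<bar>d k \<omega>\<bar>" for k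
    proof -
      have "AE \<omega> in M. cexp (\<lambda>\<omega>. clip (K k) (X \<omega>) + (X \<omega> - clip (K k) (X \<omega>))) \<omega>
          = cexp (\<lambda>\<omega>. clip (K k) (X \<omega>)) \<omega> + d k \<omega>"
        unfolding d_def using Xi clip_int[of k] by (intro AE_cexp_add Bochner_Integration.integrable_diff)
      then show ?thesis
        using Ya[of k]
      proof eventually_elim
        fix \<omega>
        assume 1: "cexp (\<lambda>\<omega>. clip (K k) (X \<omega>) + (X \<omega> - clip (K k) (X \<omega>))) \<omega> = cexp (\<lambda>\<omega>. clip (K k) (X \<omega>)) \<omega> + d k \<omega>"
          and 2: "\<bar>(\<Sum>j<n k. clip (K k) (Y k j \<omega>)) / n k - cexp (\<lambda>\<omega>. clip (K k) (X \<omega>)) \<omega>\<bar> \<le> 4 * K k / n k"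
        have "real (n k) = 4 * K k * K k" by (simp add: K_def n_def power2_eq_square algebra_simps)
        moreover have "0 < K k" by (simp add: K_def)
        ultimately have "4 * K k / n k = 1 / K k" by simp
        then have 3: "4 * K k / n k = 1 / real (Suc k)" by (simp only: K_def)
        have 4: "(\<Sum>j<n k. Y k j \<omega>) / real (n k) = (\<Sum>j<n k. clip (K k) (Y k j \<omega>)) / n k + b k \<omega>"
          by (simp add: b_def sum_subtractf diff_divide_distrib)
        have 5: "cexp X \<omega> = cexp (\<lambda>\<omega>. clip (K k) (X \<omega>)) \<omega> + d k \<omega>" using 1 by simp
        show "\<bar>(\<Sum>j<n k. Y k j \<omega>) / real (n k) - cexp X \<omega>\<bar> \<le> 1 / real (Suc k) + \<bar>b k \<omega>\<bar> + \<bar>d k \<omega>\<bar>"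
          using 2 unfolding 3 4 5 by linarith
      qed
    qed
    show "modular M \<Phi> c (b k) \<le> \<tau> k" for k
      unfolding b_def[abs_def]
    proof (rule modular_average_le[OF c(1) n0])
      fix j assume j: "j < n k"
      show "(\<lambda>\<omega>. Y k j \<omega> - clip (K k) (Y k j \<omega>)) \<in> borel_measurable M"
        using Ym[OF j] by measurable
      show "modular M \<Phi> c (\<lambda>\<omega>. Y k j \<omega> - clip (K k) (Y k j \<omega>)) \<le> \<tau> k"
        using modular_distr[OF c(1) Ym[OF j] Xm Yd[OF j], of "\<lambda>x. x - clip (K k) x"] by (simp add: \<tau>_def)
    qed
    show "modular M \<Phi> c (d k) \<le> \<tau> k" for k
      unfolding d_def \<tau>_def using Xi clip_int[of k]
      by (intro modular_cexp_le[OF p _ c(1)] Bochner_Integration.integrable_diff)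
    show "\<tau> \<longlonglongrightarrow> 0"
      unfolding \<tau>_def[abs_def] K_def using c by (intro modular_tail_tendsto_0) (auto intro: le_less_trans)
  qed (simp_all add: c(1))
qed

text \<open>Membership can be tested against the indicators of finite partitions, by averaging
  the approximating elements over the level sets of the truncations of \<open>X\<close>.\<close>

lemma C_weakly_closed:
  assumes XL: "X \<in> orlicz_space M \<Phi>"
    and approx: "\<And>p m e. labelled_prob_space M p m \<Longrightarrow> 0 < e \<Longrightarrow>
      \<exists>Z\<in>C. \<forall>i<m. \<bar>(\<integral>\<omega>. Z \<omega> * indicator {\<omega>\<in>space M. p \<omega> = i} \<omega> \<partial>M)
        - (\<integral>\<omega>. X \<omega> * indicator {\<omega>\<in>space M. p \<omega> = i} \<omega> \<partial>M)\<bar> < e"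
  shows "X \<in> C"
proof -
  obtain c where c: "0 < c" "modular M \<Phi> c X \<le> 1" and Xm[measurable]: "X \<in> borel_measurable M"
    using orlicz_spaceE[OF XL] by blast
  have Xi: "integrable M X" by (rule orlicz_space_integrable[OF XL])
  define K where "K k = real (Suc k)" for k
  have K0: "0 < K k" for k by (simp add: K_def)
  have clip_int: "integrable M (\<lambda>\<omega>. clip (K k) (X \<omega>))" for k
    using abs_clip_le[of "K k"] K0[of k] by (intro integrable_const_bound[of _ "K k"]) auto
  \<comment> \<open>Labels the level sets of the truncation with mesh \<open>1 / K k\<close>; adding
    \<open>K k\<close> makes the values nonnegative before rounding.\<close>
  define p where "p k \<omega> = nat \<lfloor>(clip (K k) (X \<omega>) + K k) * K k\<rfloor>" for k \<omega>
  define m where "m k = Suc (nat \<lfloor>2 * K k * K k\<rfloor>)" for k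
  define \<tau> where "\<tau> k = modular M \<Phi> c (\<lambda>\<omega>. X \<omega> - clip (K k) (X \<omega>))" for k
  have p: "labelled_prob_space M (p k) (m k)" for k
  proof
    show "p k \<in> measurable M (count_space UNIV)" unfolding p_def[abs_def] by measurable
    fix \<omega>
    have "(clip (K k) (X \<omega>) + K k) * K k \<le> (2 * K k) * K k"
      using abs_clip_le[of "K k" "X \<omega>"] K0[of k] by (intro mult_right_mono) auto
    then have "nat \<lfloor>(clip (K k) (X \<omega>) + K k) * K k\<rfloor> \<le> nat \<lfloor>2 * K k * K k\<rfloor>"
      by (intro nat_mono floor_mono) simp
    then show "p k \<omega> < m k" by (simp add: p_def m_def)
  qed
  have osc: "\<bar>clip (K k) (X \<omega>) - clip (K k) (X \<omega>')\<bar> \<le> 1 / K k" if "p k \<omega> = p k \<omega>'" for k \<omega> \<omega>'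
  proof -
    let ?f = "\<lambda>\<omega>. (clip (K k) (X \<omega>) + K k) * K k"
    have nn: "0 \<le> ?f \<omega>" for \<omega>
      using abs_clip_le[of "K k" "X \<omega>"] K0[of k] by (intro mult_nonneg_nonneg) auto
    have "\<lfloor>?f \<omega>\<rfloor> = \<lfloor>?f \<omega>'\<rfloor>" using that nn[of \<omega>] nn[of \<omega>'] by (simp add: p_def nat_eq_iff)
    then have "\<bar>?f \<omega> - ?f \<omega>'\<bar> \<le> 1" by linarith
    moreover have "?f \<omega> - ?f \<omega>' = (clip (K k) (X \<omega>) - clip (K k) (X \<omega>')) * K k" by (simp add: algebra_simps)
    ultimately have "\<bar>clip (K k) (X \<omega>) - clip (K k) (X \<omega>')\<bar> * K k \<le> 1"
      using K0[of k] by (simp add: abs_mult)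
    then show ?thesis using K0[of k] by (simp add: field_simps)
  qed
  have "\<exists>Z\<in>C. AE \<omega> in M. \<bar>labelled_prob_space.cexp M (p k) Z \<omega> - labelled_prob_space.cexp M (p k) X \<omega>\<bar> \<le> 1 / K k" for k
  proof -
    interpret labelled_prob_space M "p k" "m k" by (rule p)
    \<comment> \<open>Dividing by the mass of a cell turns integrals into conditional means;
      \<open>e\<close> compensates for the lightest cell of positive mass. Inserting 1 keeps the set
      nonempty.\<close>
    define e where "e = Min (insert 1 ((\<lambda>i. prob (cell i) / K k) ` {i\<in>{..<m k}. 0 < prob (cell i)}))"
    have e0: "0 < e" unfolding e_def using K0[of k] by (subst Min_gr_iff) auto
    have e1: "e \<le> prob (cell i) / K k" if "i < m k" "0 < prob (cell i)" for i
      unfolding e_def using that by (intro Min_le) auto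
    obtain Z where Z: "Z \<in> C" "\<And>i. i < m k \<Longrightarrow> \<bar>(\<integral>\<omega>. Z \<omega> * indicator (cell i) \<omega> \<partial>M) - (\<integral>\<omega>. X \<omega> * indicator (cell i) \<omega> \<partial>M)\<bar> < e"
      using approx[OF p e0, of k] unfolding cell_def by blast
    have [measurable]: "Z \<in> borel_measurable M" using Z(1) C_subset orlicz_space_measurable by blast
    have "AE \<omega> in M. \<bar>cexp Z \<omega> - cexp X \<omega>\<bar> \<le> 1 / K k"
      using AE_cell_pos
    proof (rule eventually_mono)
      fix \<omega> assume pos: "0 < prob (cell (p k \<omega>))"
      let ?i = "p k \<omega>"
      have "\<bar>cexp Z \<omega> - cexp X \<omega>\<bar> = \<bar>(\<integral>\<omega>. Z \<omega> * indicator (cell ?i) \<omega> \<partial>M) - (\<integral>\<omega>. X \<omega> * indicator (cell ?i) \<omega> \<partial>M)\<bar> / prob (cell ?i)"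
        using pos by (simp add: cexp_eq_divide diff_divide_distrib[symmetric])
      also have "\<dots> \<le> (prob (cell ?i) / K k) / prob (cell ?i)"
        using Z(2)[OF p_less] e1[OF p_less pos] by (intro divide_right_mono) (auto intro: order_trans less_imp_le)
      also have "\<dots> = 1 / K k" using pos by simp
      finally show "\<bar>cexp Z \<omega> - cexp X \<omega>\<bar> \<le> 1 / K k" .
    qed
    with Z(1) show ?thesis by blast
  qed
  then obtain Z where ZC: "\<And>k. Z k \<in> C"
    and Za: "\<And>k. AE \<omega> in M. \<bar>labelled_prob_space.cexp M (p k) (Z k) \<omega> - labelled_prob_space.cexp M (p k) X \<omega>\<bar> \<le> 1 / K k"
    by metis
  \<comment> \<open>Here \<open>b\<close> is the conditional mean of the tail and \<open>d\<close>
    the tail itself. The factor 2 in the uniform error below covers the distance between the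
    conditional means of \<open>Z k\<close> and \<open>X\<close>, and the oscillation of the
    truncation on a cell.\<close>
  define b where "b k = labelled_prob_space.cexp M (p k) (\<lambda>\<omega>. X \<omega> - clip (K k) (X \<omega>))" for k
  define d where "d k \<omega> = X \<omega> - clip (K k) (X \<omega>)" for k \<omega>
  show ?thesis
  proof (rule C_approximation[OF XL, where Zs = "\<lambda>k. labelled_prob_space.cexp M (p k) (Z k)" and b = b and d = d
        and \<delta> = "\<lambda>k. 2 * (1 / real (Suc k))" and \<tau> = \<tau> and c = c])
    show "labelled_prob_space.cexp M (p k) (Z k) \<in> C" for k by (rule C_cexp[OF ZC p])
    show "b k \<in> borel_measurable M" for k
      unfolding b_def by (rule labelled_prob_space.cexp_measurable[OF p])
    show "d k \<in> borel_measurable M" for k unfolding d_def[abs_def] by measurable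
    have "(\<lambda>k. 1 / real (Suc k)) \<longlonglongrightarrow> 0" using LIMSEQ_inverse_real_of_nat by (simp add: inverse_eq_divide)
    from tendsto_mult[OF tendsto_const this, of 2] show "(\<lambda>k. 2 * (1 / real (Suc k))) \<longlonglongrightarrow> 0" by simp
    show "AE \<omega> in M. \<bar>labelled_prob_space.cexp M (p k) (Z k) \<omega> - X \<omega>\<bar> \<le> 2 * (1 / real (Suc k)) + \<bar>b k \<omega>\<bar> + \<bar>d k \<omega>\<bar>" for k
    proof -
      interpret labelled_prob_space M "p k" "m k" by (rule p)
      have "AE \<omega> in M. cexp (\<lambda>\<omega>. clip (K k) (X \<omega>) + (X \<omega> - clip (K k) (X \<omega>))) \<omega>
          = cexp (\<lambda>\<omega>. clip (K k) (X \<omega>)) \<omega> + b k \<omega>"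
        unfolding b_def using Xi clip_int[of k] by (intro AE_cexp_add Bochner_Integration.integrable_diff)
      then show ?thesis using Za[of k] AE_cell_pos
      proof eventually_elim
        fix \<omega>
        assume 1: "cexp (\<lambda>\<omega>. clip (K k) (X \<omega>) + (X \<omega> - clip (K k) (X \<omega>))) \<omega> = cexp (\<lambda>\<omega>. clip (K k) (X \<omega>)) \<omega> + b k \<omega>"
          and 2: "\<bar>cexp (Z k) \<omega> - cexp X \<omega>\<bar> \<le> 1 / K k" and pos: "0 < prob (cell (p k \<omega>))"
        let ?N = "cond (p k \<omega>)"
        interpret c: prob_space ?N using pos by (rule prob_space_cond)
        have int: "integrable ?N (\<lambda>\<omega>. clip (K k) (X \<omega>))" by (rule integrable_cond[OF clip_int pos])
        \<comment> \<open>The truncation varies by at most \<open>1 / K k\<close> on a cell, so its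
          conditional mean is that close to its value at \<open>\<omega>\<close>.\<close>
        have "\<bar>c.expectation (\<lambda>\<omega>'. clip (K k) (X \<omega>') - clip (K k) (X \<omega>))\<bar> \<le> c.expectation (\<lambda>\<omega>'. \<bar>clip (K k) (X \<omega>') - clip (K k) (X \<omega>)\<bar>)"
          by (rule integral_abs_bound)
        also have "\<dots> \<le> c.expectation (\<lambda>\<omega>'. 1 / K k)"
        proof (rule integral_mono_AE)
          show "AE \<omega>' in ?N. \<bar>clip (K k) (X \<omega>') - clip (K k) (X \<omega>)\<bar> \<le> 1 / K k"
            using AE_cond_cell[of "p k \<omega>"] by (rule eventually_mono) (rule osc)
        qed (use int in simp_all)
        finally have 3: "\<bar>cexp (\<lambda>\<omega>. clip (K k) (X \<omega>)) \<omega> - clip (K k) (X \<omega>)\<bar> \<le> 1 / K k"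
          using int c.prob_space by (simp add: cexp_def)
        have 4: "cexp X \<omega> = cexp (\<lambda>\<omega>. clip (K k) (X \<omega>)) \<omega> + b k \<omega>" using 1 by simp
        show "\<bar>cexp (Z k) \<omega> - X \<omega>\<bar> \<le> 2 * (1 / real (Suc k)) + \<bar>b k \<omega>\<bar> + \<bar>d k \<omega>\<bar>"
          using 2 3 4 unfolding d_def K_def by linarith
      qed
    qed
    show "modular M \<Phi> c (b k) \<le> \<tau> k" for k
      unfolding b_def \<tau>_def using Xi clip_int[of k]
      by (intro modular_cexp_le[OF p _ c(1)] Bochner_Integration.integrable_diff)
    show "modular M \<Phi> c (d k) \<le> \<tau> k" for k by (simp add: d_def[abs_def] \<tau>_def)
    show "\<tau> \<longlonglongrightarrow> 0"
      unfolding \<tau>_def[abs_def] K_def using c by (intro modular_tail_tendsto_0) (auto intro: le_less_trans)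
  qed (simp_all add: c(1))
qed

end

section \<open>Weak topologies and duality\<close>

lemma openin_weak_topology:
  "openin (weak_topology M \<Phi> D) U \<longleftrightarrow> generate_topology_on
     (insert (orlicz_space M \<Phi>)
       {{X \<in> orlicz_space M \<Phi>. (\<integral>\<omega>. X \<omega> * Y \<omega> \<partial>M) \<in> U} | Y U. Y \<in> D \<and> open U}) U"
  unfolding weak_topology_def by (rule openin_topology_generated_by_iff)

lemma topspace_weak_topology[simp]: "topspace (weak_topology M \<Phi> D) = orlicz_space M \<Phi>"
  unfolding weak_topology_def by auto

lemma openin_weak_topology_subbasic:
  "Y \<in> D \<Longrightarrow> open U \<Longrightarrow> openin (weak_topology M \<Phi> D) {X \<in> orlicz_space M \<Phi>. (\<integral>\<omega>. X \<omega> * Y \<omega> \<partial>M) \<in> U}"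
  unfolding openin_weak_topology by (rule generate_topology_on.Basis) blast

lemma openin_weak_topology_mono:
  assumes "D \<subseteq> D'" "openin (weak_topology M \<Phi> D) U"
  shows "openin (weak_topology M \<Phi> D') U"
  using assms(2) unfolding openin_weak_topology
proof (induction rule: generate_topology_on.induct)
  case (Basis s)
  then show ?case using assms(1) by (intro generate_topology_on.Basis) blast
qed (auto intro: generate_topology_on.intros)

lemma weakly_lsc_mono:
  assumes "D \<subseteq> D'" "weakly_lsc M \<Phi> D \<rho>"
  shows "weakly_lsc M \<Phi> D' \<rho>"
  using assms(2) openin_weak_topology_mono[OF assms(1)] unfolding weakly_lsc_def closedin_def by simp

text \<open>Convergence of the pairings handles subbasic sets, and eventual membership survives
  finite intersections and arbitrary unions.\<close>

lemma eventually_in_weakly_open: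
  assumes "openin (weak_topology M \<Phi> D) U" "X \<in> U"
    and Xs: "\<And>n. Xs n \<in> orlicz_space M \<Phi>"
    and lim: "\<And>Y. Y \<in> D \<Longrightarrow> (\<lambda>n. \<integral>\<omega>. Xs n \<omega> * Y \<omega> \<partial>M) \<longlonglongrightarrow> (\<integral>\<omega>. X \<omega> * Y \<omega> \<partial>M)"
  shows "\<forall>\<^sub>F n in sequentially. Xs n \<in> U"
  using assms(1,2) unfolding openin_weak_topology
proof (induction rule: generate_topology_on.induct)
  case (Int a b)
  then show ?case by (simp add: eventually_conj)
next
  case (UN K)
  then obtain k where k: "k \<in> K" "X \<in> k" by blast
  then have "\<forall>\<^sub>F n in sequentially. Xs n \<in> k" by (rule UN.IH)
  then show ?case by (rule eventually_mono) (use k in blast)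
next
  case (Basis s)
  show ?case
  proof (cases "s = orlicz_space M \<Phi>")
    case True
    then show ?thesis using Xs by simp
  next
    case False
    with Basis obtain Y V where s: "s = {X \<in> orlicz_space M \<Phi>. (\<integral>\<omega>. X \<omega> * Y \<omega> \<partial>M) \<in> V}" and "Y \<in> D" "open V"
      by blast
    then have "\<forall>\<^sub>F n in sequentially. (\<integral>\<omega>. Xs n \<omega> * Y \<omega> \<partial>M) \<in> V"
      using Basis.prems by (intro topological_tendstoD[OF lim]) auto
    then show ?thesis by (rule eventually_mono) (use s Xs in simp)
  qed
qed simp

section \<open>The conjugate function, Young's inequality and the pairing\<close>

context orlicz_prob_space
begin

abbreviation \<Psi> :: "real \<Rightarrow> real" where
  "\<Psi> \<equiv> orlicz_conj \<Phi>"

text \<open>Makes the real supremum defining the conjugate meaningful: beyond \<open>t0\<close>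
  superlinear growth makes the terms nonpositive, and before it they are at most
  \<open>t0 * \<bar>s\<bar>\<close>.\<close>

lemma conj_bdd_above: "bdd_above ((\<lambda>t. t * s - \<Phi> t) ` {0..})"
proof -
  obtain t0 where t0: "0 \<le> t0" "\<And>t. t0 \<le> t \<Longrightarrow> s * t \<le> \<Phi> t"
    using \<Phi>_dominates_linear[of s] by blast
  show ?thesis
  proof (rule bdd_aboveI2)
    fix t :: real assume t: "t \<in> {0..}"
    show "t * s - \<Phi> t \<le> t0 * \<bar>s\<bar>"
    proof (cases "t0 \<le> t")
      case True
      have "0 \<le> t0 * \<bar>s\<bar>" using t0(1) by simp
      then show ?thesis using t0(2)[OF True] by (simp add: mult.commute)
    next
      case False
      have "t * s \<le> t * \<bar>s\<bar>" using t by (intro mult_left_mono) auto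
      also have "\<dots> \<le> t0 * \<bar>s\<bar>" using False by (intro mult_right_mono) auto
      finally show ?thesis using \<Phi>_nonneg[of t] t by simp
    qed
  qed
qed

lemma Young: "0 \<le> t \<Longrightarrow> t * s \<le> \<Phi> t + \<Psi> s"
  using cSUP_upper[OF _ conj_bdd_above, of t s] by (simp add: orlicz_conj_def)

lemma \<Psi>_nonneg: "0 \<le> \<Psi> s"
  using Young[of 0 s] by simp

lemma \<Psi>_mono: "s \<le> s' \<Longrightarrow> \<Psi> s \<le> \<Psi> s'"
  unfolding orlicz_conj_def
  by (intro cSUP_mono conj_bdd_above) (auto intro!: bexI mult_left_mono)

text \<open>For \<open>s \<le> 1\<close> a single threshold \<open>t0\<close> works, beyond which
  the terms are nonpositive. The bound later yields a scale at which a bounded variable has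
  conjugate modular at most 1.\<close>

lemma \<Psi>_small: "\<exists>K\<ge>0. \<forall>s\<in>{0..1}. \<Psi> s \<le> K * s"
proof -
  obtain t0 where t0: "0 \<le> t0" "\<And>t. t0 \<le> t \<Longrightarrow> 1 * t \<le> \<Phi> t"
    using \<Phi>_dominates_linear[of 1] by blast
  have "\<Psi> s \<le> t0 * s" if s: "s \<in> {0..1}" for s
    unfolding orlicz_conj_def
  proof (rule cSUP_least)
    fix t :: real assume t: "t \<in> {0..}"
    show "t * s - \<Phi> t \<le> t0 * s"
    proof (cases "t0 \<le> t")
      case True
      have "t * s \<le> t * 1" using t s by (intro mult_left_mono) auto
      moreover have "0 \<le> t0 * s" using t0(1) s by simp
      ultimately show ?thesis using t0(2)[OF True] by linarith
    next
      case False
      then have "t * s \<le> t0 * s" using s by (intro mult_right_mono) auto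
      then show ?thesis using \<Phi>_nonneg[of t] t by simp
    qed
  qed simp
  with t0(1) show ?thesis by blast
qed

lemma Linfty_subset_heart: "Linfty M \<subseteq> orlicz_heart M \<Psi>"
proof
  fix Y assume "Y \<in> Linfty M"
  then obtain B where [measurable]: "Y \<in> borel_measurable M" and "AE \<omega> in M. \<bar>Y \<omega>\<bar> \<le> B"
    by (auto simp: Linfty_def)
  then have B: "AE \<omega> in M. \<bar>Y \<omega>\<bar> \<le> max 1 B" by (auto elim!: eventually_mono)
  have le: "(\<integral>\<^sup>+ \<omega>. ennreal (\<Psi> (\<bar>Y \<omega>\<bar> / c)) \<partial>M) \<le> ennreal (\<Psi> (max 1 B / c))" if c: "0 < c" for c
  proof -
    have "AE \<omega> in M. ennreal (\<Psi> (\<bar>Y \<omega>\<bar> / c)) \<le> ennreal (\<Psi> (max 1 B / c))"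
      using B by (rule eventually_mono) (use c in \<open>intro ennreal_leI \<Psi>_mono divide_right_mono; simp\<close>)
    then have "(\<integral>\<^sup>+ \<omega>. ennreal (\<Psi> (\<bar>Y \<omega>\<bar> / c)) \<partial>M) \<le> (\<integral>\<^sup>+ \<omega>. ennreal (\<Psi> (max 1 B / c)) \<partial>M)"
      by (rule nn_integral_mono_AE)
    then show ?thesis by (simp add: emeasure_space_1)
  qed
  obtain K where K: "0 \<le> K" "\<And>s. s \<in> {0..1} \<Longrightarrow> \<Psi> s \<le> K * s" using \<Psi>_small by blast
  \<comment> \<open>This scale maps the bound \<open>max 1 B\<close> to \<open>1 / max 1 K\<close>,
    inside the range of the linear estimate, which then gives at most 1.\<close>
  define c where "c = max 1 B * max 1 K"
  have c: "0 < c" by (simp add: c_def)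
  have s: "max 1 B / c = 1 / max 1 K" by (simp add: c_def)
  have "\<Psi> (1 / max 1 K) \<le> K * (1 / max 1 K)" by (intro K(2)) simp
  also have "\<dots> \<le> 1" using K(1) by simp
  finally have "ennreal (\<Psi> (max 1 B / c)) \<le> 1" unfolding s by (simp add: ennreal_le_1)
  with le[OF c] have "(\<integral>\<^sup>+ \<omega>. ennreal (\<Psi> (\<bar>Y \<omega>\<bar> / c)) \<partial>M) \<le> 1" by (rule order_trans)
  then have "Y \<in> orlicz_space M \<Psi>" using c by (auto simp: orlicz_space_def)
  moreover have "(\<integral>\<^sup>+ \<omega>. ennreal (\<Psi> (\<bar>Y \<omega>\<bar> / c)) \<partial>M) < \<infinity>" if "0 < c" for c
    using le[OF that] by (rule le_less_trans) simp
  ultimately show "Y \<in> orlicz_heart M \<Psi>" by (simp add: orlicz_heart_def)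
qed

lemma heart_subset_space: "orlicz_heart M \<Psi> \<subseteq> orlicz_space M \<Psi>"
  by (auto simp: orlicz_heart_def)

text \<open>Young's inequality for \<open>\<bar>X \<omega>\<bar> / a\<close> and
  \<open>\<bar>Y \<omega>\<bar> / b\<close>, at scales where both modulars are at most 1.\<close>

lemma integrable_pairing:
  assumes X: "X \<in> orlicz_space M \<Phi>" and Y: "Y \<in> orlicz_space M \<Psi>"
  shows "integrable M (\<lambda>\<omega>. X \<omega> * Y \<omega>)"
proof -
  obtain a where a: "0 < a" "modular M \<Phi> a X \<le> 1" and [measurable]: "X \<in> borel_measurable M"
    using orlicz_spaceE[OF X] by blast
  obtain b where b: "0 < b" "(\<integral>\<^sup>+ \<omega>. ennreal (\<Psi> (\<bar>Y \<omega>\<bar> / b)) \<partial>M) \<le> 1" and [measurable]: "Y \<in> borel_measurable M"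
    using Y by (auto simp: orlicz_space_def)
  have "mono_on {0..} \<Psi>" by (intro mono_onI \<Psi>_mono)
  from mono_on_abs_measurable[OF this b(1)] \<Phi>_measurable[OF a(1)]
  have [measurable]: "(\<lambda>x. \<Psi> (\<bar>x\<bar> / b)) \<in> borel_measurable borel" "(\<lambda>x. \<Phi> (\<bar>x\<bar> / a)) \<in> borel_measurable borel" .
  have "(\<integral>\<^sup>+ \<omega>. ennreal (norm (X \<omega> / a * (Y \<omega> / b))) \<partial>M)
      \<le> (\<integral>\<^sup>+ \<omega>. ennreal (\<Phi> (\<bar>X \<omega>\<bar> / a)) + ennreal (\<Psi> (\<bar>Y \<omega>\<bar> / b)) \<partial>M)"
  proof (rule nn_integral_mono)
    fix \<omega>
    have "norm (X \<omega> / a * (Y \<omega> / b)) \<le> \<Phi> (\<bar>X \<omega>\<bar> / a) + \<Psi> (\<bar>Y \<omega>\<bar> / b)"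
      using Young[of "\<bar>X \<omega>\<bar> / a" "\<bar>Y \<omega>\<bar> / b"] a b by (simp add: abs_mult)
    then show "ennreal (norm (X \<omega> / a * (Y \<omega> / b))) \<le> ennreal (\<Phi> (\<bar>X \<omega>\<bar> / a)) + ennreal (\<Psi> (\<bar>Y \<omega>\<bar> / b))"
      using a \<Psi>_nonneg by (simp add: ennreal_plus[symmetric] \<Phi>_nonneg ennreal_leI del: ennreal_plus)
  qed
  also have "\<dots> = modular M \<Phi> a X + (\<integral>\<^sup>+ \<omega>. ennreal (\<Psi> (\<bar>Y \<omega>\<bar> / b)) \<partial>M)"
    unfolding modular_def by (rule nn_integral_add) measurable
  also have "\<dots> \<le> 1 + 1" using a b by (intro add_mono)
  also have "\<dots> < \<infinity>" by simp
  finally have "integrable M (\<lambda>\<omega>. X \<omega> / a * (Y \<omega> / b))"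
    by (intro integrableI_bounded) measurable
  then have "integrable M (\<lambda>\<omega>. (a * b) * (X \<omega> / a * (Y \<omega> / b)))" by (rule integrable_mult_right)
  then show ?thesis using a b by simp
qed

text \<open>Dominated almost sure limits are weak limits, each pairing having an integrable bound,
  so the sequence eventually enters every weakly open set around its limit.\<close>

lemma weakly_lsc_imp_fatou:
  assumes lsc: "weakly_lsc M \<Phi> (orlicz_space M \<Psi>) \<rho>"
  shows "fatou_property M \<Phi> \<rho>"
  unfolding fatou_property_def
proof (intro allI impI, elim conjE)
  fix Xs X Y
  assume Xs: "\<forall>n. Xs n \<in> orlicz_space M \<Phi>" and X: "X \<in> orlicz_space M \<Phi>" and Y: "Y \<in> orlicz_space M \<Phi>"
    and conv: "AE \<omega> in M. (\<lambda>n. Xs n \<omega>) \<longlonglongrightarrow> X \<omega>" and dom: "\<forall>n. AE \<omega> in M. \<bar>Xs n \<omega>\<bar> \<le> Y \<omega>"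
  have lim: "(\<lambda>n. \<integral>\<omega>. Xs n \<omega> * Z \<omega> \<partial>M) \<longlonglongrightarrow> (\<integral>\<omega>. X \<omega> * Z \<omega> \<partial>M)" if Z: "Z \<in> orlicz_space M \<Psi>" for Z
  proof (rule integral_dominated_convergence[where w = "\<lambda>\<omega>. \<bar>Y \<omega> * Z \<omega>\<bar>"])
    have Zm: "Z \<in> borel_measurable M" using Z by (simp add: orlicz_space_def)
    show "(\<lambda>\<omega>. X \<omega> * Z \<omega>) \<in> borel_measurable M"
      using orlicz_space_measurable[OF X] Zm by (rule borel_measurable_times)
    show "(\<lambda>\<omega>. Xs n \<omega> * Z \<omega>) \<in> borel_measurable M" for n
      using orlicz_space_measurable[OF Xs[rule_format]] Zm by (rule borel_measurable_times)
    show "integrable M (\<lambda>\<omega>. \<bar>Y \<omega> * Z \<omega>\<bar>)" by (intro integrable_abs integrable_pairing Y Z)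
    show "AE \<omega> in M. (\<lambda>n. Xs n \<omega> * Z \<omega>) \<longlonglongrightarrow> X \<omega> * Z \<omega>"
      using conv by (rule eventually_mono) (rule tendsto_mult_right)
    show "AE \<omega> in M. norm (Xs n \<omega> * Z \<omega>) \<le> \<bar>Y \<omega> * Z \<omega>\<bar>" for n
      using dom[rule_format, of n] by (rule eventually_mono) (auto simp: abs_mult intro!: mult_right_mono)
  qed
  show "\<rho> X \<le> liminf (\<lambda>n. \<rho> (Xs n))"
  proof (rule ccontr)
    assume "\<not> ?thesis"
    then have "liminf (\<lambda>n. \<rho> (Xs n)) < \<rho> X" by simp
    \<comment> \<open>Sublevel sets have real levels, so a real \<open>c\<close> is placed strictly
      between the extended values; the complement of its sublevel set is a neighbourhood of
      \<open>X\<close>.\<close>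
    then obtain c where c: "liminf (\<lambda>n. \<rho> (Xs n)) < ereal c" "ereal c < \<rho> X"
      using ereal_dense2 by blast
    let ?U = "orlicz_space M \<Phi> - {X \<in> orlicz_space M \<Phi>. \<rho> X \<le> ereal c}"
    have "openin (weak_topology M \<Phi> (orlicz_space M \<Psi>)) ?U"
      using lsc by (simp add: weakly_lsc_def closedin_def)
    from eventually_in_weakly_open[OF this _ _ lim]
    have "\<forall>\<^sub>F n in sequentially. Xs n \<in> ?U" using X Xs c(2) by (simp add: not_le)
    then have "\<forall>\<^sub>F n in sequentially. ereal c \<le> \<rho> (Xs n)"
      by (rule eventually_mono) (auto simp: not_le intro: less_imp_le)
    then have "ereal c \<le> liminf (\<lambda>n. \<rho> (Xs n))" by (rule Liminf_bounded)
    with c(1) show False by simp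
  qed
qed

end

section \<open>Weak closedness of the sublevel sets\<close>

context fatou_closed_set
begin

text \<open>For \<open>X\<close> outside \<open>C\<close>, \<open>C_weakly_closed\<close> yields a
  partition and an \<open>e\<close> such that no element of \<open>C\<close> is
  \<open>e\<close>-close to \<open>X\<close> on all cells. Indicators of cells are bounded, so these
  finitely many conditions define a weak neighbourhood of \<open>X\<close> missing
  \<open>C\<close>.\<close>

lemma C_closedin: "closedin (weak_topology M \<Phi> (Linfty M)) C"
proof -
  let ?W = "weak_topology M \<Phi> (Linfty M)"
  have "openin ?W (orlicz_space M \<Phi> - C)"
  proof (subst openin_subopen, intro ballI)
    fix X assume X: "X \<in> orlicz_space M \<Phi> - C"
    define I where "I p i Z = (\<integral>\<omega>. Z \<omega> * indicator {\<omega>\<in>space M. p \<omega> = i} \<omega> \<partial>M)"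
      for p :: "'a \<Rightarrow> nat" and i and Z :: "'a \<Rightarrow> real"
    have "\<exists>p m e. labelled_prob_space M p m \<and> 0 < e \<and> (\<forall>Z\<in>C. \<not> (\<forall>i<m. \<bar>I p i Z - I p i X\<bar> < e))"
      using C_weakly_closed[of X] X unfolding I_def by blast
    then obtain p m e where p: "labelled_prob_space M p m" and e: "0 < e"
      and far: "\<And>Z. Z \<in> C \<Longrightarrow> \<not> (\<forall>i<m. \<bar>I p i Z - I p i X\<bar> < e)" by blast
    interpret labelled_prob_space M p m by (rule p)
    define T where "T i = {Z \<in> orlicz_space M \<Phi>. I p i Z \<in> ball (I p i X) e}" for i
    have "openin ?W (T i)" for i
      unfolding T_def I_def
    proof (rule openin_weak_topology_subbasic)
      show "indicator {\<omega>\<in>space M. p \<omega> = i} \<in> Linfty M"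
        by (auto simp: Linfty_def indicator_def intro!: exI[of _ 1])
    qed simp
    then have "openin ?W (orlicz_space M \<Phi> \<inter> (\<Inter>i\<in>{..<m}. T i))"
      using openin_INT[of "{..<m}" ?W T] by (simp add: Int_commute)
    moreover have "X \<in> orlicz_space M \<Phi> \<inter> (\<Inter>i\<in>{..<m}. T i)"
      using X e by (simp add: T_def)
    moreover have "orlicz_space M \<Phi> \<inter> (\<Inter>i\<in>{..<m}. T i) \<subseteq> orlicz_space M \<Phi> - C"
      using far by (auto simp: T_def dist_real_def abs_minus_commute)
    ultimately show "\<exists>T. openin ?W T \<and> X \<in> T \<and> T \<subseteq> orlicz_space M \<Phi> - C" by blast
  qed
  then show ?thesis using C_subset by (simp add: closedin_def)
qed

end

text \<open>Every sublevel set at a real level is an instance of \<open>fatou_closed_set\<close>;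
  the Fatou property keeps a dominated limit at the same level.\<close>

lemma (in orlicz_prob_space) fatou_imp_weakly_lsc_Linfty:
  assumes na: "nonatomic M" and qc: "quasiconvex M \<Phi> \<rho>" and law: "law_invariant M \<Phi> \<rho>"
    and fatou: "fatou_property M \<Phi> \<rho>"
  shows "weakly_lsc M \<Phi> (Linfty M) \<rho>"
  unfolding weakly_lsc_def
proof
  fix c :: real
  interpret fatou_closed_set M \<Phi> "{X \<in> orlicz_space M \<Phi>. \<rho> X \<le> ereal c}"
  proof
    show "nonatomic M" by (rule na)
  next
    fix X Y :: "'a \<Rightarrow> real" and t :: real
    assume "X \<in> {X \<in> orlicz_space M \<Phi>. \<rho> X \<le> ereal c}" "Y \<in> {X \<in> orlicz_space M \<Phi>. \<rho> X \<le> ereal c}" "0 \<le> t" "t \<le> 1"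
    then show "(\<lambda>\<omega>. t * X \<omega> + (1 - t) * Y \<omega>) \<in> {X \<in> orlicz_space M \<Phi>. \<rho> X \<le> ereal c}"
      using qc[unfolded quasiconvex_def, rule_format, of X c Y t] by simp
  next
    fix X Y :: "'a \<Rightarrow> real"
    assume "X \<in> {X \<in> orlicz_space M \<Phi>. \<rho> X \<le> ereal c}" "Y \<in> orlicz_space M \<Phi>" "distr M borel X = distr M borel Y"
    then show "Y \<in> {X \<in> orlicz_space M \<Phi>. \<rho> X \<le> ereal c}"
      using law[unfolded law_invariant_def, rule_format, of X Y] by simp
  next
    fix Xs :: "nat \<Rightarrow> 'a \<Rightarrow> real" and X Y :: "'a \<Rightarrow> real"
    assume Xs: "\<And>n. Xs n \<in> {X \<in> orlicz_space M \<Phi>. \<rho> X \<le> ereal c}" and X: "X \<in> orlicz_space M \<Phi>" and "Y \<in> orlicz_space M \<Phi>"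
      "AE \<omega> in M. (\<lambda>n. Xs n \<omega>) \<longlonglongrightarrow> X \<omega>" "\<And>n. AE \<omega> in M. \<bar>Xs n \<omega>\<bar> \<le> Y \<omega>"
    then have "\<rho> X \<le> liminf (\<lambda>n. \<rho> (Xs n))"
      using fatou[unfolded fatou_property_def, rule_format, of Xs X Y] by simp
    also have "\<dots> \<le> liminf (\<lambda>n. ereal c)"
      using Xs by (intro Liminf_mono always_eventually) simp
    also have "\<dots> = ereal c" by (simp add: Liminf_const)
    finally show "X \<in> {X \<in> orlicz_space M \<Phi>. \<rho> X \<le> ereal c}" using X by simp
  qed simp
  show "closedin (weak_topology M \<Phi> (Linfty M)) {X \<in> orlicz_space M \<Phi>. \<rho> X \<le> ereal c}"
    by (rule C_closedin)
qed

theorem theorem1: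
  fixes M :: "'a measure" and \<Phi> :: "real \<Rightarrow> real"
    and \<rho> :: "('a \<Rightarrow> real) \<Rightarrow> ereal"
  assumes "prob_space M" and "nonatomic M"
    and "orlicz_function \<Phi>"
    and "\<And>t. t > 0 \<Longrightarrow> \<Phi> t > 0"
    and "((\<lambda>t. \<Phi> t / t) \<longlongrightarrow> \<infinity>) at_top"
    and "\<And>X. X \<in> orlicz_space M \<Phi> \<Longrightarrow> \<rho> X \<noteq> -\<infinity>"
    and "proper_fun M \<Phi> \<rho>" and "quasiconvex M \<Phi> \<rho>" and "law_invariant M \<Phi> \<rho>"
  shows "(weakly_lsc M \<Phi> (Linfty M) \<rho> \<longleftrightarrow> weakly_lsc M \<Phi> (orlicz_heart M (orlicz_conj \<Phi>)) \<rho>)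
       \<and> (weakly_lsc M \<Phi> (orlicz_heart M (orlicz_conj \<Phi>)) \<rho> \<longleftrightarrow>
            weakly_lsc M \<Phi> (orlicz_space M (orlicz_conj \<Phi>)) \<rho>)
       \<and> (weakly_lsc M \<Phi> (orlicz_space M (orlicz_conj \<Phi>)) \<rho> \<longleftrightarrow> fatou_property M \<Phi> \<rho>)"
proof -
  interpret prob_space M by fact
  interpret orlicz_prob_space M \<Phi> by unfold_locales fact+
  \<comment> \<open>The implications form a cycle: enlarging the dual space leads from
    \<open>Linfty M\<close> through the heart to the full conjugate space, then to the Fatou
    property and back to \<open>Linfty M\<close>.\<close>
  show ?thesis
    using weakly_lsc_mono[OF Linfty_subset_heart, of M \<Phi> \<rho>] weakly_lsc_mono[OF heart_subset_space, of M \<Phi> \<rho>]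
      weakly_lsc_imp_fatou[of \<rho>] fatou_imp_weakly_lsc_Linfty[OF assms(2,8,9)] by blast
qed

end
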